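(* Let $\mathbf{P}\colon \mathsf{C}^{\mathrm{op}}\to\mathsf{BA}$ be a Boolean doctrine with $\mathsf{C}$ a small category, and let $F=(F_X)_{X\in\mathsf{C}}$ be a family with $F_X\subseteq \mathbf{P}(X)$ for each $X\in\mathsf{C}$. The following are equivalent: (1) there is a propositional model $(M,\mathfrak{m})$ of $\mathbf{P}$ such that for every $X\in\mathsf{C}$, $F_X=\{\alpha\in\mathbf{P}(X)\mid \text{for all } x\in M(X),\ x\in\mathfrak{m}_X(\alpha)\}$; (2) $F$ is a universal ultrafilter for $\mathbf{P}$.
   Context: All categories have finite products; $\mathbf{t}$ denotes a terminal object, $\mathrm{pr}_i$ the $i$-th product projection. $\mathsf{BA}$ is the category of Boolean algebras and Boolean homomorphisms. A Boolean doctrine over $\mathsf{C}$ is a functor $\mathbf{P}\colon\mathsf{C}^{\mathrm{op}}\to\mathsf{BA}$. A Boolean doctrine morphism from $\mathbf{P}\colon\mathsf{C}^{\mathrm{op}}\to\mathsf{BA}$ to $\mathbf{R}\colon\mathsf{D}^{\mathrm{op}}\to\mathsf{BA}$ is a pair $(M,\mathfrak{m})$ with $M\colon\mathsf{C}\to\mathsf{D}$ a finite-product-preserving functor and $\mathfrak{m}\colon\mathbf{P}\Rightarrow\mathbf{R}\circ M^{\mathrm{op}}$ a natural transformation. The subsets doctrine $\mathscr{P}\colon\mathsf{Set}^{\mathrm{op}}\to\mathsf{BA}$ sends a set to its power set Boolean algebra and a function $f$ to the preimage map $f^{-1}[-]$. A propositional model of $\mathbf{P}$ is a Boolean doctrine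 morphism $(M,\mathfrak{m})\colon\mathbf{P}\to\mathscr{P}$ (the sets $M(X)$ may be empty). A universal ultrafilter for $\mathbf{P}$ is a family $(F_X)_{X\in\mathsf{C}}$ with $F_X\subseteq\mathbf{P}(X)$ such that: (i) for all $f\colon X\to Y$ and $\alpha\in F_Y$, $\mathbf{P}(f)(\alpha)\in F_X$; (ii) each $F_X$ is a filter of $\mathbf{P}(X)$; (iii) for all $\alpha_1\in\mathbf{P}(X_1)$, $\alpha_2\in\mathbf{P}(X_2)$, if $\mathbf{P}(\mathrm{pr}_1)(\alpha_1)\lor\mathbf{P}(\mathrm{pr}_2)(\alpha_2)\in F_{X_1\times X_2}$ then $\alpha_1\in F_{X_1}$ or $\alpha_2\in F_{X_2}$; (iv) $\bot_{\mathbf{P}(\mathbf{t})}\notin F_{\mathbf{t}}$. *)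

theory Defs
  imports "HOL-Algebra.Complete_Lattice" "HOL-Library.Equipollence"
begin

section \<open>Boolean algebras\<close>

locale boolean_alg = bounded_lattice L for L (structure) +
  assumes meet_join_distrib:
    "\<lbrakk>x \<in> carrier L; y \<in> carrier L; z \<in> carrier L\<rbrakk>
      \<Longrightarrow> x \<sqinter> (y \<squnion> z) = (x \<sqinter> y) \<squnion> (x \<sqinter> z)"
    and complemented:
    "x \<in> carrier L \<Longrightarrow> \<exists>y\<in>carrier L. x \<squnion> y = \<top> \<and> x \<sqinter> y = \<bottom>"

definition compl :: "('p, 'm) gorder_scheme \<Rightarrow> 'p \<Rightarrow> 'p" where
  "compl L x = (THE y. y \<in> carrier L \<and> x \<squnion>\<^bsub>L\<^esub> y = \<top>\<^bsub>L\<^esub> \<and> x \<sqinter>\<^bsub>L\<^esub> y = \<bottom>\<^bsub>L\<^esub>)"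

definition boolean_hom ::
  "('p, 'm) gorder_scheme \<Rightarrow> ('q, 'n) gorder_scheme \<Rightarrow> ('p \<Rightarrow> 'q) \<Rightarrow> bool" where
  "boolean_hom K L h \<longleftrightarrow>
     h \<in> carrier K \<rightarrow> carrier L \<and>
     h \<top>\<^bsub>K\<^esub> = \<top>\<^bsub>L\<^esub> \<and> h \<bottom>\<^bsub>K\<^esub> = \<bottom>\<^bsub>L\<^esub> \<and>
     (\<forall>x\<in>carrier K. \<forall>y\<in>carrier K.
        h (x \<squnion>\<^bsub>K\<^esub> y) = h x \<squnion>\<^bsub>L\<^esub> h y \<and> h (x \<sqinter>\<^bsub>K\<^esub> y) = h x \<sqinter>\<^bsub>L\<^esub> h y) \<and>
     (\<forall>x\<in>carrier K. h (compl K x) = compl L (h x))"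

text \<open>Filters need not be proper.\<close>

definition lattice_filter :: "('p, 'm) gorder_scheme \<Rightarrow> 'p set \<Rightarrow> bool" where
  "lattice_filter L S \<longleftrightarrow>
     S \<subseteq> carrier L \<and> S \<noteq> {} \<and>
     (\<forall>x\<in>S. \<forall>y\<in>S. x \<sqinter>\<^bsub>L\<^esub> y \<in> S) \<and>
     (\<forall>x\<in>S. \<forall>y\<in>carrier L. x \<sqsubseteq>\<^bsub>L\<^esub> y \<longrightarrow> y \<in> S)"


section \<open>Categories with finite products\<close>

text \<open>\<open>Comp C g f\<close> is the composite of \<open>f\<close> followed by \<open>g\<close>.\<close>

record ('o, 'a) cat =
  Obj :: "'o set"
  Arr :: "'a set"
  Dom :: "'a \<Rightarrow> 'o"
  Cod :: "'a \<Rightarrow> 'o"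
  Id :: "'o \<Rightarrow> 'a"
  Comp :: "'a \<Rightarrow> 'a \<Rightarrow> 'a"

definition Hom :: "('o, 'a) cat \<Rightarrow> 'o \<Rightarrow> 'o \<Rightarrow> 'a set" where
  "Hom C X Y = {f \<in> Arr C. Dom C f = X \<and> Cod C f = Y}"

locale category =
  fixes C :: "('o, 'a) cat"
  assumes Dom_in: "f \<in> Arr C \<Longrightarrow> Dom C f \<in> Obj C"
    and Cod_in: "f \<in> Arr C \<Longrightarrow> Cod C f \<in> Obj C"
    and Id_in: "X \<in> Obj C \<Longrightarrow> Id C X \<in> Hom C X X"
    and Comp_in: "\<lbrakk>f \<in> Hom C X Y; g \<in> Hom C Y Z\<rbrakk> \<Longrightarrow> Comp C g f \<in> Hom C X Z"
    and Comp_Id_right: "f \<in> Hom C X Y \<Longrightarrow> Comp C f (Id C X) = f"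
    and Comp_Id_left: "f \<in> Hom C X Y \<Longrightarrow> Comp C (Id C Y) f = f"
    and Comp_assoc: "\<lbrakk>f \<in> Hom C W X; g \<in> Hom C X Y; h \<in> Hom C Y Z\<rbrakk>
      \<Longrightarrow> Comp C h (Comp C g f) = Comp C (Comp C h g) f"

definition is_terminal :: "('o, 'a) cat \<Rightarrow> 'o \<Rightarrow> bool" where
  "is_terminal C T \<longleftrightarrow> T \<in> Obj C \<and> (\<forall>X\<in>Obj C. \<exists>!f. f \<in> Hom C X T)"

definition is_product :: "('o, 'a) cat \<Rightarrow> 'o \<Rightarrow> 'o \<Rightarrow> 'o \<Rightarrow> 'a \<Rightarrow> 'a \<Rightarrow> bool" where
  "is_product C X Y Z p q \<longleftrightarrow>
     X \<in> Obj C \<and> Y \<in> Obj C \<and> Z \<in> Obj C \<and> p \<in> Hom C Z X \<and> q \<in> Hom C Z Y \<and>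
     (\<forall>W\<in>Obj C. \<forall>f\<in>Hom C W X. \<forall>g\<in>Hom C W Y.
        \<exists>!h. h \<in> Hom C W Z \<and> Comp C p h = f \<and> Comp C q h = g)"

locale fp_category = category +
  assumes ex_terminal: "\<exists>T. is_terminal C T"
    and ex_product: "\<lbrakk>X \<in> Obj C; Y \<in> Obj C\<rbrakk> \<Longrightarrow> \<exists>Z p q. is_product C X Y Z p q"

record ('o, 'a, 'o2, 'a2) func =
  FObj :: "'o \<Rightarrow> 'o2"
  FArr :: "'a \<Rightarrow> 'a2"

locale cat_functor = dom: category C + cod: category D
  for C :: "('o, 'a) cat" and D :: "('o2, 'a2) cat" and M :: "('o, 'a, 'o2, 'a2) func" +
  assumes FObj_in: "X \<in> Obj C \<Longrightarrow> FObj M X \<in> Obj D"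
    and FArr_in: "f \<in> Hom C X Y \<Longrightarrow> FArr M f \<in> Hom D (FObj M X) (FObj M Y)"
    and FArr_Id: "X \<in> Obj C \<Longrightarrow> FArr M (Id C X) = Id D (FObj M X)"
    and FArr_Comp: "\<lbrakk>f \<in> Hom C X Y; g \<in> Hom C Y Z\<rbrakk>
      \<Longrightarrow> FArr M (Comp C g f) = Comp D (FArr M g) (FArr M f)"

locale fp_functor = cat_functor +
  assumes preserves_terminal: "is_terminal C T \<Longrightarrow> is_terminal D (FObj M T)"
    and preserves_product: "is_product C X Y Z p q
      \<Longrightarrow> is_product D (FObj M X) (FObj M Y) (FObj M Z) (FArr M p) (FArr M q)"


section \<open>Boolean doctrines and their morphisms\<close>

text \<open>
  A contravariant functor into Boolean algebras, given by its fibres and its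
  reindexing maps. Reindexing maps matter only on the carriers of the fibres.
\<close>

record ('o, 'a, 'p) doctrine =
  Fib :: "'o \<Rightarrow> 'p gorder"
  Reidx :: "'a \<Rightarrow> 'p \<Rightarrow> 'p"

locale boolean_doctrine = fp_category C
  for C :: "('o, 'a) cat" and P :: "('o, 'a, 'p) doctrine" +
  assumes Fib_boolean: "X \<in> Obj C \<Longrightarrow> boolean_alg (Fib P X)"
    and Reidx_hom: "f \<in> Hom C X Y \<Longrightarrow> boolean_hom (Fib P Y) (Fib P X) (Reidx P f)"
    and Reidx_Id: "\<lbrakk>X \<in> Obj C; \<alpha> \<in> carrier (Fib P X)\<rbrakk> \<Longrightarrow> Reidx P (Id C X) \<alpha> = \<alpha>"
    and Reidx_Comp: "\<lbrakk>f \<in> Hom C X Y; g \<in> Hom C Y Z; \<alpha> \<in> carrier (Fib P Z)\<rbrakk>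
      \<Longrightarrow> Reidx P (Comp C g f) \<alpha> = Reidx P f (Reidx P g \<alpha>)"

locale boolean_doctrine_morphism =
  src: boolean_doctrine C P + tgt: boolean_doctrine D R + fp_functor C D M
  for C :: "('o, 'a) cat" and P :: "('o, 'a, 'p) doctrine"
    and D :: "('o2, 'a2) cat" and R :: "('o2, 'a2, 'p2) doctrine"
    and M :: "('o, 'a, 'o2, 'a2) func" and \<mm> :: "'o \<Rightarrow> 'p \<Rightarrow> 'p2" +
  assumes component_hom: "X \<in> Obj C \<Longrightarrow> boolean_hom (Fib P X) (Fib R (FObj M X)) (\<mm> X)"
    and naturality: "\<lbrakk>f \<in> Hom C X Y; \<alpha> \<in> carrier (Fib P Y)\<rbrakk>
      \<Longrightarrow> \<mm> X (Reidx P f \<alpha>) = Reidx R (FArr M f) (\<mm> Y \<alpha>)"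


section \<open>The subsets doctrine and propositional models\<close>

text \<open>
  The type \<open>'u\<close> plays the role of the universe: the objects of \<open>Set_cat\<close> are the
  sets of elements of \<open>'u\<close>, and \<open>(A, f, B)\<close> is a function \<open>f\<close> from \<open>A\<close> to \<open>B\<close>,
  made extensional off \<open>A\<close>. Finite products exist if \<open>'u\<close> is infinite.
  A set \<open>S\<close> of any type is small relative to this universe if
  \<open>S \<lesssim> (UNIV :: 'u set)\<close>; in particular, a category \<open>C\<close> is small if
  \<open>Arr C \<lesssim> (UNIV :: 'u set)\<close>.
\<close>

type_synonym 'u set_arr = "'u set \<times> ('u \<Rightarrow> 'u) \<times> 'u set"

definition Set_cat :: "('u set, 'u set_arr) cat" where
  "Set_cat =
     \<lparr>Obj = UNIV,
      Arr = {(A, f, B). f \<in> A \<rightarrow>\<^sub>E B},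
      Dom = (\<lambda>(A, f, B). A),
      Cod = (\<lambda>(A, f, B). B),
      Id = (\<lambda>A. (A, restrict id A, A)),
      Comp = (\<lambda>(B, g, C) (A, f, B'). (A, compose A g f, C))\<rparr>"

definition subsets_doctrine :: "('u set, 'u set_arr, 'u set) doctrine" where
  "subsets_doctrine =
     \<lparr>Fib = (\<lambda>A. \<lparr>carrier = Pow A, eq = (=), le = (\<subseteq>)\<rparr>),
      Reidx = (\<lambda>(A, f, B) S. f -` S \<inter> A)\<rparr>"

definition propositional_model ::
  "('o, 'a) cat \<Rightarrow> ('o, 'a, 'p) doctrine \<Rightarrow> ('o, 'a, 'u set, 'u set_arr) func
    \<Rightarrow> ('o \<Rightarrow> 'p \<Rightarrow> 'u set) \<Rightarrow> bool" where
  "propositional_model C P M \<mm> \<longleftrightarrow>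
     boolean_doctrine_morphism C P Set_cat subsets_doctrine M \<mm>"


section \<open>Universal ultrafilters\<close>

text \<open>
  The last two conditions range over all product cones and all terminal objects,
  so no choice of finite products is involved; by stability under reindexing,
  it is equivalent to impose them on any chosen ones.
\<close>

definition universal_ultrafilter ::
  "('o, 'a) cat \<Rightarrow> ('o, 'a, 'p) doctrine \<Rightarrow> ('o \<Rightarrow> 'p set) \<Rightarrow> bool" where
  "universal_ultrafilter C P F \<longleftrightarrow>
     (\<forall>X\<in>Obj C. \<forall>Y\<in>Obj C. \<forall>f\<in>Hom C X Y. \<forall>\<alpha>\<in>F Y. Reidx P f \<alpha> \<in> F X) \<and>
     (\<forall>X\<in>Obj C. lattice_filter (Fib P X) (F X)) \<and>
     (\<forall>X\<^sub>1 X\<^sub>2 Z p\<^sub>1 p\<^sub>2. is_product C X\<^sub>1 X\<^sub>2 Z p\<^sub>1 p\<^sub>2 \<longrightarrow>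
        (\<forall>\<alpha>\<^sub>1\<in>carrier (Fib P X\<^sub>1). \<forall>\<alpha>\<^sub>2\<in>carrier (Fib P X\<^sub>2).
           Reidx P p\<^sub>1 \<alpha>\<^sub>1 \<squnion>\<^bsub>Fib P Z\<^esub> Reidx P p\<^sub>2 \<alpha>\<^sub>2 \<in> F Z \<longrightarrow> \<alpha>\<^sub>1 \<in> F X\<^sub>1 \<or> \<alpha>\<^sub>2 \<in> F X\<^sub>2)) \<and>
     (\<forall>T. is_terminal C T \<longrightarrow> \<bottom>\<^bsub>Fib P T\<^esub> \<notin> F T)"


section \<open>The subsets doctrine is a Boolean doctrine\<close>

abbreviation powerset_alg :: "'u set \<Rightarrow> 'u set gorder" where
  "powerset_alg A \<equiv> \<lparr>carrier = Pow A, eq = (=), le = (\<subseteq>)\<rparr>"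

lemma powerset_alg_ops:
  shows powerset_join: "S \<subseteq> A \<Longrightarrow> T \<subseteq> A \<Longrightarrow> S \<squnion>\<^bsub>powerset_alg A\<^esub> T = S \<union> T"
    and powerset_meet: "S \<subseteq> A \<Longrightarrow> T \<subseteq> A \<Longrightarrow> S \<sqinter>\<^bsub>powerset_alg A\<^esub> T = S \<inter> T"
    and powerset_top: "\<top>\<^bsub>powerset_alg A\<^esub> = A"
    and powerset_bottom: "\<bottom>\<^bsub>powerset_alg A\<^esub> = {}"
proof -
  interpret complete_lattice "powerset_alg A"
    by (rule powerset_is_complete_lattice)
  show "S \<squnion>\<^bsub>powerset_alg A\<^esub> T = S \<union> T" if "S \<subseteq> A" "T \<subseteq> A"
  proof -
    show ?thesis
      using that join_closed[of S T] join_left[of S T] join_right[of S T] join_le[of S "S \<union> T" T]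
      by auto
  qed
  show "S \<sqinter>\<^bsub>powerset_alg A\<^esub> T = S \<inter> T" if "S \<subseteq> A" "T \<subseteq> A"
    using that meet_left[of S T] meet_right[of S T] meet_le[of "S \<inter> T" S T] by auto
  show "\<top>\<^bsub>powerset_alg A\<^esub> = A"
    using top_closed top_higher[of A] by auto
  show "\<bottom>\<^bsub>powerset_alg A\<^esub> = {}"
    using bottom_closed bottom_lower[of "{}"] by auto
qed

lemma powerset_boolean_alg: "boolean_alg (powerset_alg A)"
proof -
  interpret complete_lattice "powerset_alg A"
    by (rule powerset_is_complete_lattice)
  show ?thesis
  proof
    fix x y z
    assume "x \<in> carrier (powerset_alg A)" "y \<in> carrier (powerset_alg A)"
      "z \<in> carrier (powerset_alg A)"
    then have *: "x \<subseteq> A" "y \<subseteq> A" "z \<subseteq> A" by auto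
    then have "y \<union> z \<subseteq> A" "x \<inter> y \<subseteq> A" "x \<inter> z \<subseteq> A" by auto
    with * show "x \<sqinter>\<^bsub>powerset_alg A\<^esub> (y \<squnion>\<^bsub>powerset_alg A\<^esub> z) =
      (x \<sqinter>\<^bsub>powerset_alg A\<^esub> y) \<squnion>\<^bsub>powerset_alg A\<^esub> (x \<sqinter>\<^bsub>powerset_alg A\<^esub> z)"
      by (simp add: powerset_alg_ops Int_Un_distrib)
  next
    fix x
    assume "x \<in> carrier (powerset_alg A)"
    then have "x \<subseteq> A" "A - x \<subseteq> A" by auto
    then show "\<exists>y\<in>carrier (powerset_alg A).
        x \<squnion>\<^bsub>powerset_alg A\<^esub> y = \<top>\<^bsub>powerset_alg A\<^esub> \<and>
        x \<sqinter>\<^bsub>powerset_alg A\<^esub> y = \<bottom>\<^bsub>powerset_alg A\<^esub>"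
      by (intro bexI[of _ "A - x"]) (auto simp: powerset_alg_ops)
  qed
qed

lemma powerset_compl: "S \<subseteq> A \<Longrightarrow> compl (powerset_alg A) S = A - S"
  unfolding compl_def by (rule the_equality) (auto simp: powerset_alg_ops)

lemma preimage_boolean_hom:
  assumes "f \<in> A \<rightarrow> B"
  shows "boolean_hom (powerset_alg B) (powerset_alg A) (\<lambda>S. f -` S \<inter> A)"
proof -
  have le: "f -` S \<inter> A \<subseteq> A" for S by auto
  have "f -` B \<inter> A = A" using assms by auto
  moreover have "f -` (B - S) \<inter> A = A - f -` S \<inter> A" for S using assms by auto
  ultimately show ?thesis
    unfolding boolean_hom_def
    by (auto simp: powerset_alg_ops powerset_compl le)
qed

lemma Hom_Set_cat: "\<phi> \<in> Hom Set_cat A B \<longleftrightarrow> (\<exists>f \<in> A \<rightarrow>\<^sub>E B. \<phi> = (A, f, B))"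
  by (auto simp: Hom_def Set_cat_def)

lemma Set_cat_simps:
  "Obj Set_cat = UNIV"
  "Id Set_cat A = (A, restrict id A, A)"
  "Comp Set_cat (B, g, C) (A, f, B') = (A, compose A g f, C)"
  by (auto simp: Set_cat_def)

lemma Set_cat_category: "category Set_cat"
proof
  fix f :: "'a set_arr" assume "f \<in> Arr Set_cat"
  show "Dom Set_cat f \<in> Obj Set_cat" "Cod Set_cat f \<in> Obj Set_cat"
    by (auto simp: Set_cat_simps)
next
  fix X :: "'a set"
  show "Id Set_cat X \<in> Hom Set_cat X X"
    by (auto simp: Hom_Set_cat Set_cat_simps)
next
  fix f g :: "'a set_arr" and X Y Z
  assume "f \<in> Hom Set_cat X Y" "g \<in> Hom Set_cat Y Z"
  then show "Comp Set_cat g f \<in> Hom Set_cat X Z"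
    by (fastforce simp: Hom_Set_cat Set_cat_simps compose_def)
next
  fix f :: "'a set_arr" and X Y
  assume "f \<in> Hom Set_cat X Y"
  then show "Comp Set_cat f (Id Set_cat X) = f" "Comp Set_cat (Id Set_cat Y) f = f"
    by (auto simp: Hom_Set_cat Set_cat_simps compose_def fun_eq_iff PiE_iff extensional_def)
next
  fix f g h :: "'a set_arr" and W X Y Z
  assume "f \<in> Hom Set_cat W X" "g \<in> Hom Set_cat X Y" "h \<in> Hom Set_cat Y Z"
  then show "Comp Set_cat h (Comp Set_cat g f) = Comp Set_cat (Comp Set_cat h g) f"
    by (auto simp: Hom_Set_cat Set_cat_simps compose_def fun_eq_iff PiE_iff)
qed

lemma infinite_pairing:
  includes cardinal_syntax
  assumes "infinite (UNIV :: 'u set)"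
  obtains pair :: "'u \<times> 'u \<Rightarrow> 'u" where "inj pair"
proof -
  have "|(UNIV :: 'u set) \<times> (UNIV :: 'u set)| \<le>o |UNIV :: 'u set|"
    using card_of_Times_same_infinite[OF assms] ordIso_iff_ordLeq by blast
  then show ?thesis
    using that by (auto simp: card_of_ordLeq[symmetric])
qed

lemma Set_cat_fp:
  assumes "infinite (UNIV :: 'u set)"
  shows "fp_category (Set_cat :: ('u set, 'u set_arr) cat)"
proof -
  interpret category "Set_cat :: ('u set, 'u set_arr) cat"
    by (rule Set_cat_category)
  show ?thesis
  proof
    have "\<exists>!\<phi>. \<phi> \<in> Hom Set_cat X {undefined}" for X :: "'u set"
    proof (rule ex1I[of _ "(X, \<lambda>x\<in>X. undefined, {undefined})"])
      show "(X, \<lambda>x\<in>X. undefined, {undefined}) \<in> Hom Set_cat X {undefined}"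
        by (auto simp: Hom_Set_cat)
    qed (auto simp: Hom_Set_cat fun_eq_iff PiE_iff extensional_def)
    then show "\<exists>T :: 'u set. is_terminal Set_cat T"
      by (auto simp: is_terminal_def Set_cat_simps)
  next
    fix X Y :: "'u set"
    obtain pair :: "'u \<times> 'u \<Rightarrow> 'u" where inj: "inj pair"
      using infinite_pairing[OF assms] .
    define Z where "Z = pair ` (X \<times> Y)"
    define p where "p = (\<lambda>z\<in>Z. fst (inv pair z))"
    define q where "q = (\<lambda>z\<in>Z. snd (inv pair z))"
    have pq: "p (pair (x, y)) = x" "q (pair (x, y)) = y" if "x \<in> X" "y \<in> Y" for x y
      using that inj by (auto simp: p_def q_def Z_def)
    have p: "p \<in> Z \<rightarrow>\<^sub>E X" and q: "q \<in> Z \<rightarrow>\<^sub>E Y"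
      using inj by (auto simp: p_def q_def Z_def)
    have univ: "\<exists>!\<phi>. \<phi> \<in> Hom Set_cat W Z \<and> Comp Set_cat (Z, p, X) \<phi> = (W, f, X) \<and>
        Comp Set_cat (Z, q, Y) \<phi> = (W, g, Y)"
      if f: "f \<in> W \<rightarrow>\<^sub>E X" and g: "g \<in> W \<rightarrow>\<^sub>E Y" for W f g
    proof (rule ex1I[of _ "(W, \<lambda>w\<in>W. pair (f w, g w), Z)"])
      have fg: "f w \<in> X" "g w \<in> Y" if "w \<in> W" for w using f g that by auto
      have "compose W p (\<lambda>w\<in>W. pair (f w, g w)) = f"
        using f fg pq by (auto simp: compose_def fun_eq_iff PiE_iff extensional_def)
      moreover have "compose W q (\<lambda>w\<in>W. pair (f w, g w)) = g"
        using g fg pq by (auto simp: compose_def fun_eq_iff PiE_iff extensional_def)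
      moreover have "(\<lambda>w\<in>W. pair (f w, g w)) \<in> W \<rightarrow>\<^sub>E Z"
        using fg by (auto simp: Z_def)
      ultimately show "(W, \<lambda>w\<in>W. pair (f w, g w), Z) \<in> Hom Set_cat W Z \<and>
          Comp Set_cat (Z, p, X) (W, \<lambda>w\<in>W. pair (f w, g w), Z) = (W, f, X) \<and>
          Comp Set_cat (Z, q, Y) (W, \<lambda>w\<in>W. pair (f w, g w), Z) = (W, g, Y)"
        by (auto simp: Hom_Set_cat Set_cat_simps)
    next
      fix \<phi>
      assume "\<phi> \<in> Hom Set_cat W Z \<and> Comp Set_cat (Z, p, X) \<phi> = (W, f, X) \<and>
        Comp Set_cat (Z, q, Y) \<phi> = (W, g, Y)"
      then obtain h where h: "h \<in> W \<rightarrow>\<^sub>E Z" "\<phi> = (W, h, Z)"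
        "compose W p h = f" "compose W q h = g"
        by (auto simp: Hom_Set_cat Set_cat_simps)
      have "h w = pair (f w, g w)" if w: "w \<in> W" for w
      proof -
        obtain x y where "x \<in> X" "y \<in> Y" "h w = pair (x, y)"
          using h(1) w by (fastforce simp: Z_def)
        moreover have "f w = p (h w)" "g w = q (h w)"
          using h(3,4) w by (auto simp: compose_def)
        ultimately show ?thesis by (simp add: pq)
      qed
      then have "h = (\<lambda>w\<in>W. pair (f w, g w))"
        using h(1) by (auto simp: fun_eq_iff PiE_iff extensional_def)
      then show "\<phi> = (W, \<lambda>w\<in>W. pair (f w, g w), Z)" using h(2) by simp
    qed
    have "is_product Set_cat X Y Z (Z, p, X) (Z, q, Y)"
      unfolding is_product_def Set_cat_simps
    proof (intro conjI UNIV_I ballI)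
      show "(Z, p, X) \<in> Hom Set_cat Z X" "(Z, q, Y) \<in> Hom Set_cat Z Y"
        using p q by (auto simp: Hom_Set_cat)
    next
      fix W \<phi> \<psi>
      assume "\<phi> \<in> Hom Set_cat W X" "\<psi> \<in> Hom Set_cat W Y"
      then obtain f g where fg: "f \<in> W \<rightarrow>\<^sub>E X" "g \<in> W \<rightarrow>\<^sub>E Y"
        and eqs: "\<phi> = (W, f, X)" "\<psi> = (W, g, Y)"
        by (auto simp: Hom_Set_cat)
      show "\<exists>!h. h \<in> Hom Set_cat W Z \<and> Comp Set_cat (Z, p, X) h = \<phi> \<and>
          Comp Set_cat (Z, q, Y) h = \<psi>"
        unfolding eqs by (rule univ[OF fg])
    qed
    then show "\<exists>Z p q. is_product Set_cat X Y Z p q" by blast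
  qed
qed

theorem subsets_boolean_doctrine:
  assumes "infinite (UNIV :: 'u set)"
  shows "boolean_doctrine (Set_cat :: ('u set, 'u set_arr) cat) subsets_doctrine"
proof (intro boolean_doctrine.intro boolean_doctrine_axioms.intro)
  show "fp_category (Set_cat :: ('u set, 'u set_arr) cat)"
    by (rule Set_cat_fp[OF assms])
next
  fix X :: "'u set" assume "X \<in> Obj Set_cat"
  show "boolean_alg (Fib subsets_doctrine X)"
    by (simp add: subsets_doctrine_def powerset_boolean_alg)
next
  fix f :: "'u set_arr" and X Y
  assume "f \<in> Hom Set_cat X Y"
  then show "boolean_hom (Fib subsets_doctrine Y) (Fib subsets_doctrine X)
      (Reidx subsets_doctrine f)"
    by (auto simp: Hom_Set_cat subsets_doctrine_def PiE_iff intro!: preimage_boolean_hom)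
next
  fix X \<alpha> :: "'u set"
  assume "X \<in> Obj Set_cat" "\<alpha> \<in> carrier (Fib subsets_doctrine X)"
  then show "Reidx subsets_doctrine (Id Set_cat X) \<alpha> = \<alpha>"
    by (auto simp: Set_cat_simps subsets_doctrine_def)
next
  fix f g :: "'u set_arr" and X Y Z \<alpha>
  assume "f \<in> Hom Set_cat X Y" "g \<in> Hom Set_cat Y Z" "\<alpha> \<in> carrier (Fib subsets_doctrine Z)"
  then show "Reidx subsets_doctrine (Comp Set_cat g f) \<alpha> =
      Reidx subsets_doctrine f (Reidx subsets_doctrine g \<alpha>)"
    by (auto simp: Hom_Set_cat Set_cat_simps subsets_doctrine_def compose_def)
qed

end

theory Submission
  imports Defs "HOL-Algebra.Free_Abelian_Groups"
begin

text \<open>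
  Validity in a model satisfies the primeness condition (iii) because a model preserves binary
  products: counterexamples to two formulas in separate variables combine to a counterexample to
  their disjunction.

  Conversely, given a universal ultrafilter \<open>F\<close>, take one new constant of sort \<open>X\<close> for each
  \<open>\<alpha> \<in> P(X) - F(X)\<close>. For a finite set \<open>S\<close> of constants let \<open>Z S\<close> be the product of their sorts. The
  functor \<open>Y \<mapsto> colim Hom(Z S, Y)\<close> (the terms of sort \<open>Y\<close> in the new constants) preserves finite
  products, being a directed colimit of representables. By (iii) and (iv), no disjunction of finitely
  many of the formulas \<open>\<alpha>\<close>, each at its own constant, lies in \<open>F(Z S)\<close>. Hence the formulas in the
  \<open>F(Z S)\<close> together with the negations of the \<open>\<alpha>\<close> at their constants are consistent, and Zorn's lemma
  extends them to ultrafilters on the \<open>P(Z S)\<close> compatible with reindexing. A term satisfies a formula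
  iff the formula reindexed along the term lies in the ultrafilter.
\<close>

section \<open>Boolean algebras and filters\<close>

context boolean_alg
begin

lemma le_iff_meet: "\<lbrakk>x \<in> carrier L; y \<in> carrier L\<rbrakk> \<Longrightarrow> x \<sqsubseteq> y \<longleftrightarrow> x \<sqinter> y = x"
  by (metis le_antisym le_refl meet_closed meet_le meet_left meet_right)

lemma meet_top [simp]: "x \<in> carrier L \<Longrightarrow> x \<sqinter> \<top> = x"
  by (metis le_iff_meet top_closed top_higher)

lemma join_bottom [simp]: "x \<in> carrier L \<Longrightarrow> x \<squnion> \<bottom> = x"
  by (metis bottom_closed bottom_lower join_closed join_le join_left le_antisym le_refl)

lemma join_mono:
  assumes "x \<sqsubseteq> x'" "y \<sqsubseteq> y'" "x \<in> carrier L" "y \<in> carrier L" "x' \<in> carrier L" "y' \<in> carrier L"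
  shows "x \<squnion> y \<sqsubseteq> x' \<squnion> y'"
  using assms by (meson join_closed join_le join_left join_right le_trans)

lemma meet_mono:
  assumes "x \<sqsubseteq> x'" "y \<sqsubseteq> y'" "x \<in> carrier L" "y \<in> carrier L" "x' \<in> carrier L" "y' \<in> carrier L"
  shows "x \<sqinter> y \<sqsubseteq> x' \<sqinter> y'"
  using assms by (meson meet_closed meet_le meet_left meet_right le_trans)

text \<open>Meeting \<open>y\<close> with \<open>x \<squnion> z = \<top>\<close> and distributing
  leaves \<open>y \<sqinter> z\<close>, and symmetrically for \<open>z\<close>. This justifies the
  definite description in \<open>compl\<close>.\<close>

lemma complement_unique:
  assumes "x \<in> carrier L" "y \<in> carrier L" "z \<in> carrier L"
    and "x \<squnion> y = \<top>" "x \<sqinter> y = \<bottom>" "x \<squnion> z = \<top>" "x \<sqinter> z = \<bottom>"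
  shows "y = z"
proof -
  have "y = y \<sqinter> z"
    using assms meet_join_distrib[of y x z]
    by (metis bottom_closed join_bottom join_comm meet_closed meet_comm meet_top)
  moreover have "z = z \<sqinter> y"
    using assms meet_join_distrib[of z x y]
    by (metis bottom_closed join_bottom join_comm meet_closed meet_comm meet_top)
  ultimately show ?thesis by (metis meet_comm)
qed

lemma
  assumes "x \<in> carrier L"
  shows compl_closed [simp]: "compl L x \<in> carrier L"
    and join_compl: "x \<squnion> compl L x = \<top>"
    and meet_compl: "x \<sqinter> compl L x = \<bottom>"
proof -
  have "\<exists>!y. y \<in> carrier L \<and> x \<squnion> y = \<top> \<and> x \<sqinter> y = \<bottom>"
    using complemented[OF assms] complement_unique[OF assms] by blast
  from theI'[OF this]
  show "compl L x \<in> carrier L" "x \<squnion> compl L x = \<top>" "x \<sqinter> compl L x = \<bottom>"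
    unfolding compl_def by auto
qed

text \<open>The half of the dual distributive law that does not hold in every lattice, obtained by
  distributing the left side twice. It later gives closure of \<open>refuting\<close> under
  meets.\<close>

lemma join_meet_distrib_le:
  assumes [simp]: "x \<in> carrier L" "y \<in> carrier L" "z \<in> carrier L"
  shows "(x \<squnion> z) \<sqinter> (y \<squnion> z) \<sqsubseteq> (x \<sqinter> y) \<squnion> z"
proof -
  have "(x \<squnion> z) \<sqinter> (y \<squnion> z) = ((x \<squnion> z) \<sqinter> y) \<squnion> ((x \<squnion> z) \<sqinter> z)"
    by (simp add: meet_join_distrib)
  moreover have "(x \<squnion> z) \<sqinter> y = (x \<sqinter> y) \<squnion> (y \<sqinter> z)"
    using meet_join_distrib[of y x z] meet_comm[of L] by simp
  moreover have "(x \<sqinter> y) \<squnion> (y \<sqinter> z) \<sqsubseteq> (x \<sqinter> y) \<squnion> z"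
    by (intro join_mono meet_right) auto
  moreover have "(x \<squnion> z) \<sqinter> z \<sqsubseteq> (x \<sqinter> y) \<squnion> z"
    by (meson assms join_closed join_right le_trans meet_closed meet_right)
  ultimately show ?thesis
    by (simp add: join_le)
qed

text \<open>Meet \<open>y\<close> with \<open>x \<squnion> compl L x = \<top>\<close>; the part
  below \<open>x\<close> vanishes.\<close>

lemma le_of_disjoint_compl:
  assumes "x \<in> carrier L" "y \<in> carrier L" "y \<sqinter> x = \<bottom>"
  shows "y \<sqsubseteq> compl L x"
proof -
  have "y = y \<sqinter> (x \<squnion> compl L x)" using assms by (simp add: join_compl)
  also have "\<dots> = y \<sqinter> compl L x"
    using assms by (simp add: meet_join_distrib join_comm[of L \<bottom>])
  finally show ?thesis using assms by (simp add: le_iff_meet)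
qed

end

lemma
  assumes "lattice_filter L S"
  shows lattice_filter_carrier: "x \<in> S \<Longrightarrow> x \<in> carrier L"
    and lattice_filter_meet: "x \<in> S \<Longrightarrow> y \<in> S \<Longrightarrow> x \<sqinter>\<^bsub>L\<^esub> y \<in> S"
    and lattice_filter_up: "x \<in> S \<Longrightarrow> x \<sqsubseteq>\<^bsub>L\<^esub> y \<Longrightarrow> y \<in> carrier L \<Longrightarrow> y \<in> S"
  using assms unfolding lattice_filter_def by auto

lemma (in boolean_alg) lattice_filter_top: "lattice_filter L S \<Longrightarrow> \<top> \<in> S"
  unfolding lattice_filter_def by (meson ex_in_conv subsetD top_closed top_higher)

text \<open>Phrased by deciding every element rather than by maximality, since Zorn's lemma will
  yield maximality of a whole family of filters and not of each filter separately.\<close>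

definition ultrafilter :: "('p, 'm) gorder_scheme \<Rightarrow> 'p set \<Rightarrow> bool" where
  "ultrafilter L U \<longleftrightarrow>
     lattice_filter L U \<and> \<bottom>\<^bsub>L\<^esub> \<notin> U \<and> (\<forall>x\<in>carrier L. x \<in> U \<or> compl L x \<in> U)"

context boolean_alg
begin

lemma ultrafilter_compl:
  assumes "ultrafilter L U" "x \<in> carrier L"
  shows "compl L x \<in> U \<longleftrightarrow> x \<notin> U"
  using assms meet_compl[of x] unfolding ultrafilter_def lattice_filter_def by metis

lemma ultrafilter_meet:
  assumes "ultrafilter L U" "x \<in> carrier L" "y \<in> carrier L"
  shows "x \<sqinter> y \<in> U \<longleftrightarrow> x \<in> U \<and> y \<in> U"
  using assms meet_left[of x y] meet_right[of x y]
  unfolding ultrafilter_def lattice_filter_def by metis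

text \<open>If \<open>y\<close> is outside \<open>U\<close>, its complement is inside; meeting the
  join with that complement cancels \<open>y\<close> and leaves an element below
  \<open>x\<close>.\<close>

lemma ultrafilter_join:
  assumes U: "ultrafilter L U" and [simp]: "x \<in> carrier L" "y \<in> carrier L"
  shows "x \<squnion> y \<in> U \<longleftrightarrow> x \<in> U \<or> y \<in> U"
proof
  assume xy: "x \<squnion> y \<in> U"
  show "x \<in> U \<or> y \<in> U"
  proof (rule disjCI)
    assume "y \<notin> U"
    then have "compl L y \<sqinter> (x \<squnion> y) \<in> U"
      using U xy by (simp add: ultrafilter_meet ultrafilter_compl)
    also have "compl L y \<sqinter> (x \<squnion> y) = compl L y \<sqinter> x"
      by (simp add: meet_join_distrib meet_comm[of L "compl L y" y] meet_compl)
    finally show "x \<in> U" using U by (simp add: ultrafilter_meet)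
  qed
next
  assume "x \<in> U \<or> y \<in> U"
  with U show "x \<squnion> y \<in> U"
    using join_left[of x y] join_right[of x y]
    by (auto simp: ultrafilter_def intro: lattice_filter_up)
qed

end

section \<open>Reindexing as Boolean homomorphisms\<close>

context boolean_doctrine
begin

lemma Hom_Obj: "f \<in> Hom C X Y \<Longrightarrow> X \<in> Obj C" "f \<in> Hom C X Y \<Longrightarrow> Y \<in> Obj C"
  using Dom_in Cod_in by (auto simp: Hom_def)

lemma
  assumes f: "f \<in> Hom C X Y"
  shows Reidx_closed: "\<alpha> \<in> carrier (Fib P Y) \<Longrightarrow> Reidx P f \<alpha> \<in> carrier (Fib P X)"
    and Reidx_top: "Reidx P f \<top>\<^bsub>Fib P Y\<^esub> = \<top>\<^bsub>Fib P X\<^esub>"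
    and Reidx_bottom: "Reidx P f \<bottom>\<^bsub>Fib P Y\<^esub> = \<bottom>\<^bsub>Fib P X\<^esub>"
    and Reidx_join: "\<lbrakk>\<alpha> \<in> carrier (Fib P Y); \<beta> \<in> carrier (Fib P Y)\<rbrakk>
      \<Longrightarrow> Reidx P f (\<alpha> \<squnion>\<^bsub>Fib P Y\<^esub> \<beta>) = Reidx P f \<alpha> \<squnion>\<^bsub>Fib P X\<^esub> Reidx P f \<beta>"
    and Reidx_meet: "\<lbrakk>\<alpha> \<in> carrier (Fib P Y); \<beta> \<in> carrier (Fib P Y)\<rbrakk>
      \<Longrightarrow> Reidx P f (\<alpha> \<sqinter>\<^bsub>Fib P Y\<^esub> \<beta>) = Reidx P f \<alpha> \<sqinter>\<^bsub>Fib P X\<^esub> Reidx P f \<beta>"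
    and Reidx_compl: "\<alpha> \<in> carrier (Fib P Y)
      \<Longrightarrow> Reidx P f (compl (Fib P Y) \<alpha>) = compl (Fib P X) (Reidx P f \<alpha>)"
  using Reidx_hom[OF f] unfolding boolean_hom_def by auto

text \<open>\<open>boolean_hom\<close> does not mention the order, so monotonicity is recovered from
  preservation of meets.\<close>

lemma Reidx_mono:
  assumes f: "f \<in> Hom C X Y" and le: "\<alpha> \<sqsubseteq>\<^bsub>Fib P Y\<^esub> \<beta>"
    and in_carrier: "\<alpha> \<in> carrier (Fib P Y)" "\<beta> \<in> carrier (Fib P Y)"
  shows "Reidx P f \<alpha> \<sqsubseteq>\<^bsub>Fib P X\<^esub> Reidx P f \<beta>"
proof -
  interpret X: boolean_alg "Fib P X" using f by (intro Fib_boolean Hom_Obj)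
  interpret Y: boolean_alg "Fib P Y" using f by (intro Fib_boolean Hom_Obj)
  show ?thesis
    using Reidx_meet[OF f in_carrier] Reidx_closed[OF f] in_carrier le
    by (simp add: Y.le_iff_meet X.le_iff_meet)
qed

end


section \<open>Finite products of sets\<close>

text \<open>Elements of \<open>A\<close> correspond to arrows from the one-point set
  \<open>{undefined}\<close>; existence and uniqueness of such an arrow give exactly one
  element.\<close>

lemma is_terminal_Set_cat_iff:
  fixes A :: "'u set"
  shows "is_terminal Set_cat A \<longleftrightarrow> (\<exists>a. A = {a})"
proof
  assume A: "is_terminal Set_cat A"
  then have ex1: "\<exists>!\<phi>. \<phi> \<in> Hom Set_cat {undefined} A"
    by (auto simp: is_terminal_def Set_cat_simps)
  have const: "({undefined}, \<lambda>x\<in>{undefined}. a, A) \<in> Hom Set_cat {undefined} A" if "a \<in> A" for a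
    using that by (auto simp: Hom_Set_cat)
  from ex1 obtain f :: "'u \<Rightarrow> 'u" where "f \<in> {undefined} \<rightarrow>\<^sub>E A"
    by (metis Hom_Set_cat)
  then have "f undefined \<in> A" by auto
  moreover have "a = b" if "a \<in> A" "b \<in> A" for a b
  proof -
    have "(\<lambda>x\<in>{undefined :: 'u}. a) = (\<lambda>x\<in>{undefined}. b)"
      using ex1 const[OF that(1)] const[OF that(2)] by blast
    from fun_cong[OF this, of undefined] show ?thesis by simp
  qed
  ultimately show "\<exists>a. A = {a}" by blast
next
  assume "\<exists>a. A = {a}"
  then obtain a where A: "A = {a}" ..
  have "\<exists>!\<phi>. \<phi> \<in> Hom Set_cat X {a}" for X :: "'u set"
  proof (rule ex1I[of _ "(X, \<lambda>x\<in>X. a, {a})"])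
    show "(X, \<lambda>x\<in>X. a, {a}) \<in> Hom Set_cat X {a}" by (auto simp: Hom_Set_cat)
  qed (auto simp: Hom_Set_cat fun_eq_iff PiE_iff extensional_def)
  then show "is_terminal Set_cat A"
    by (auto simp: A is_terminal_def Set_cat_simps)
qed

text \<open>The universal property is tested on a one-point set \<open>W\<close>, whose arrows to
  \<open>A\<close> and \<open>B\<close> name \<open>a\<close> and \<open>b\<close>.\<close>

lemma is_product_Set_catD:
  assumes prod: "is_product Set_cat A B Z (Z, p, A) (Z, q, B)" and ab: "a \<in> A" "b \<in> B"
  shows "\<exists>z\<in>Z. p z = a \<and> q z = b"
proof -
  define W :: "'a set" where "W = {undefined}"
  have "(W, \<lambda>w\<in>W. a, A) \<in> Hom Set_cat W A" "(W, \<lambda>w\<in>W. b, B) \<in> Hom Set_cat W B"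
    using ab by (auto simp: Hom_Set_cat)
  then obtain \<phi> where "\<phi> \<in> Hom Set_cat W Z"
    "Comp Set_cat (Z, p, A) \<phi> = (W, \<lambda>w\<in>W. a, A)" "Comp Set_cat (Z, q, B) \<phi> = (W, \<lambda>w\<in>W. b, B)"
    using prod unfolding is_product_def Set_cat_simps by blast
  then obtain h where "h \<in> W \<rightarrow>\<^sub>E Z" "compose W p h = (\<lambda>w\<in>W. a)" "compose W q h = (\<lambda>w\<in>W. b)"
    by (auto simp: Hom_Set_cat Set_cat_simps)
  then show ?thesis
    by (intro bexI[of _ "h undefined"])
      (auto simp: W_def compose_def fun_eq_iff split: if_splits)
qed

text \<open>An elementwise criterion, which spares a comparison with a concretely constructed
  product. The mediating arrow is chosen pointwise by \<open>ex\<close> and is unique by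
  \<open>inj\<close>.\<close>

lemma is_product_Set_catI:
  assumes p: "p \<in> Z \<rightarrow>\<^sub>E A" and q: "q \<in> Z \<rightarrow>\<^sub>E B"
    and ex: "\<And>a b. a \<in> A \<Longrightarrow> b \<in> B \<Longrightarrow> \<exists>z\<in>Z. p z = a \<and> q z = b"
    and inj: "\<And>z z'. z \<in> Z \<Longrightarrow> z' \<in> Z \<Longrightarrow> p z = p z' \<Longrightarrow> q z = q z' \<Longrightarrow> z = z'"
  shows "is_product Set_cat A B Z (Z, p, A) (Z, q, B)"
  unfolding is_product_def Set_cat_simps
proof (intro conjI UNIV_I ballI)
  show "(Z, p, A) \<in> Hom Set_cat Z A" "(Z, q, B) \<in> Hom Set_cat Z B"
    using p q by (auto simp: Hom_Set_cat)
next
  fix W \<phi> \<psi>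
  assume "\<phi> \<in> Hom Set_cat W A" "\<psi> \<in> Hom Set_cat W B"
  then obtain f g where fg: "f \<in> W \<rightarrow>\<^sub>E A" "g \<in> W \<rightarrow>\<^sub>E B"
    and eqs: "\<phi> = (W, f, A)" "\<psi> = (W, g, B)"
    by (auto simp: Hom_Set_cat)
  have "\<forall>w\<in>W. \<exists>z. z \<in> Z \<and> p z = f w \<and> q z = g w"
    using fg ex by (metis PiE_mem)
  then obtain k where k: "k w \<in> Z" "p (k w) = f w" "q (k w) = g w" if "w \<in> W" for w
    by metis
  have k_in: "restrict k W \<in> W \<rightarrow>\<^sub>E Z" using k by auto
  show "\<exists>!h. h \<in> Hom Set_cat W Z \<and> Comp Set_cat (Z, p, A) h = \<phi> \<and> Comp Set_cat (Z, q, B) h = \<psi>"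
  proof (rule ex1I[of _ "(W, restrict k W, Z)"])
    show "(W, restrict k W, Z) \<in> Hom Set_cat W Z \<and>
        Comp Set_cat (Z, p, A) (W, restrict k W, Z) = \<phi> \<and>
        Comp Set_cat (Z, q, B) (W, restrict k W, Z) = \<psi>"
    proof (intro conjI)
      show "(W, restrict k W, Z) \<in> Hom Set_cat W Z"
        unfolding Hom_Set_cat using k_in by blast
    qed (use k fg in \<open>auto simp: eqs Set_cat_simps compose_def fun_eq_iff PiE_iff extensional_def\<close>)
  next
    fix h
    assume "h \<in> Hom Set_cat W Z \<and> Comp Set_cat (Z, p, A) h = \<phi> \<and> Comp Set_cat (Z, q, B) h = \<psi>"
    then obtain h' where h': "h' \<in> W \<rightarrow>\<^sub>E Z" "h = (W, h', Z)"
      "compose W p h' = f" "compose W q h' = g"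
      by (auto simp: eqs Hom_Set_cat Set_cat_simps)
    have "h' w = k w" if "w \<in> W" for w
    proof (rule inj)
      show "p (h' w) = p (k w)" "q (h' w) = q (k w)"
        using h'(3,4) k that by (auto simp: compose_def)
    qed (use h'(1) k that in auto)
    then show "h = (W, restrict k W, Z)"
      using h'(1,2) by (auto simp: fun_eq_iff PiE_iff extensional_def)
  qed
qed


section \<open>Validity in a propositional model\<close>

text \<open>Stability under reindexing is naturality, the filter laws come from preservation of top
  and meets, and bottom is not valid at a terminal object because its interpretation has a
  point.\<close>

lemma propositional_model_universal_ultrafilter:
  fixes M :: "('o, 'a, 'u set, 'u set_arr) func"
  assumes model: "propositional_model C P M \<mm>"
    and F: "\<And>X. X \<in> Obj C \<Longrightarrow> F X = {\<alpha> \<in> carrier (Fib P X). \<forall>x\<in>FObj M X. x \<in> \<mm> X \<alpha>}"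
  shows "universal_ultrafilter C P F"
proof -
  interpret boolean_doctrine_morphism C P Set_cat subsets_doctrine M \<mm>
    using model by (simp add: propositional_model_def)
  have \<mm>_sub: "\<mm> X \<alpha> \<subseteq> FObj M X" if "X \<in> Obj C" "\<alpha> \<in> carrier (Fib P X)" for X \<alpha>
    using component_hom[OF that(1)] that(2)
    by (auto simp: boolean_hom_def subsets_doctrine_def)
  have \<mm>_top: "\<mm> X \<top>\<^bsub>Fib P X\<^esub> = FObj M X" and \<mm>_bot: "\<mm> X \<bottom>\<^bsub>Fib P X\<^esub> = {}" if "X \<in> Obj C" for X
    using component_hom[OF that]
    by (auto simp: boolean_hom_def subsets_doctrine_def powerset_alg_ops)
  have \<mm>_join: "\<mm> X (\<alpha> \<squnion>\<^bsub>Fib P X\<^esub> \<beta>) = \<mm> X \<alpha> \<union> \<mm> X \<beta>"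
    and \<mm>_meet: "\<mm> X (\<alpha> \<sqinter>\<^bsub>Fib P X\<^esub> \<beta>) = \<mm> X \<alpha> \<inter> \<mm> X \<beta>"
    if "X \<in> Obj C" "\<alpha> \<in> carrier (Fib P X)" "\<beta> \<in> carrier (Fib P X)" for X \<alpha> \<beta>
    using component_hom[OF that(1)] that(2,3) \<mm>_sub[OF that(1)]
    by (auto simp: boolean_hom_def subsets_doctrine_def powerset_alg_ops)
  \<comment> \<open>Naturality in concrete form: reindexing along \<open>f\<close> is interpreted as
    preimage under the function underlying \<open>FArr M f\<close>.\<close>
  have M_arr: "\<exists>g\<in>FObj M X \<rightarrow>\<^sub>E FObj M Y. FArr M f = (FObj M X, g, FObj M Y) \<and>
      (\<forall>\<alpha>\<in>carrier (Fib P Y). \<mm> X (Reidx P f \<alpha>) = g -` \<mm> Y \<alpha> \<inter> FObj M X)"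
    if f: "f \<in> Hom C X Y" for f X Y
  proof -
    obtain g where g: "g \<in> FObj M X \<rightarrow>\<^sub>E FObj M Y" "FArr M f = (FObj M X, g, FObj M Y)"
      using FArr_in[OF f] by (auto simp: Hom_Set_cat)
    then show ?thesis
      using naturality[OF f] by (auto simp: subsets_doctrine_def)
  qed
  show ?thesis
    unfolding universal_ultrafilter_def
  proof (intro conjI ballI allI impI)
    fix X Y f \<alpha>
    assume X: "X \<in> Obj C" "Y \<in> Obj C" and f: "f \<in> Hom C X Y" and \<alpha>: "\<alpha> \<in> F Y"
    obtain g where "g \<in> FObj M X \<rightarrow>\<^sub>E FObj M Y"
      "\<forall>\<alpha>\<in>carrier (Fib P Y). \<mm> X (Reidx P f \<alpha>) = g -` \<mm> Y \<alpha> \<inter> FObj M X"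
      using M_arr[OF f] by blast
    then show "Reidx P f \<alpha> \<in> F X"
      using X \<alpha> src.Reidx_closed[OF f] by (auto simp: F)
  next
    fix X assume X: "X \<in> Obj C"
    interpret X: boolean_alg "Fib P X" by (rule src.Fib_boolean[OF X])
    have "\<mm> X \<alpha> \<subseteq> \<mm> X \<beta>"
      if "\<alpha> \<sqsubseteq>\<^bsub>Fib P X\<^esub> \<beta>" "\<alpha> \<in> carrier (Fib P X)" "\<beta> \<in> carrier (Fib P X)" for \<alpha> \<beta>
      using \<mm>_meet[OF X, of \<alpha> \<beta>] that by (auto simp: X.le_iff_meet)
    then show "lattice_filter (Fib P X) (F X)"
      using X \<mm>_top[OF X] X.top_closed
      by (auto simp: lattice_filter_def F \<mm>_meet) blast
  next
    fix X\<^sub>1 X\<^sub>2 Z p\<^sub>1 p\<^sub>2 \<alpha>\<^sub>1 \<alpha>\<^sub>2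
    assume prod: "is_product C X\<^sub>1 X\<^sub>2 Z p\<^sub>1 p\<^sub>2"
      and \<alpha>: "\<alpha>\<^sub>1 \<in> carrier (Fib P X\<^sub>1)" "\<alpha>\<^sub>2 \<in> carrier (Fib P X\<^sub>2)"
      and join: "Reidx P p\<^sub>1 \<alpha>\<^sub>1 \<squnion>\<^bsub>Fib P Z\<^esub> Reidx P p\<^sub>2 \<alpha>\<^sub>2 \<in> F Z"
    have p: "X\<^sub>1 \<in> Obj C" "X\<^sub>2 \<in> Obj C" "Z \<in> Obj C" "p\<^sub>1 \<in> Hom C Z X\<^sub>1" "p\<^sub>2 \<in> Hom C Z X\<^sub>2"
      using prod by (auto simp: is_product_def)
    obtain g\<^sub>1 where g1: "FArr M p\<^sub>1 = (FObj M Z, g\<^sub>1, FObj M X\<^sub>1)"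
      "\<mm> Z (Reidx P p\<^sub>1 \<alpha>\<^sub>1) = g\<^sub>1 -` \<mm> X\<^sub>1 \<alpha>\<^sub>1 \<inter> FObj M Z"
      using M_arr[OF p(4)] \<alpha> by blast
    obtain g\<^sub>2 where g2: "FArr M p\<^sub>2 = (FObj M Z, g\<^sub>2, FObj M X\<^sub>2)"
      "\<mm> Z (Reidx P p\<^sub>2 \<alpha>\<^sub>2) = g\<^sub>2 -` \<mm> X\<^sub>2 \<alpha>\<^sub>2 \<inter> FObj M Z"
      using M_arr[OF p(5)] \<alpha> by blast
    show "\<alpha>\<^sub>1 \<in> F X\<^sub>1 \<or> \<alpha>\<^sub>2 \<in> F X\<^sub>2"
    proof (rule ccontr)
      assume "\<not> (\<alpha>\<^sub>1 \<in> F X\<^sub>1 \<or> \<alpha>\<^sub>2 \<in> F X\<^sub>2)"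
      then obtain x\<^sub>1 x\<^sub>2 where x: "x\<^sub>1 \<in> FObj M X\<^sub>1" "x\<^sub>2 \<in> FObj M X\<^sub>2"
        "x\<^sub>1 \<notin> \<mm> X\<^sub>1 \<alpha>\<^sub>1" "x\<^sub>2 \<notin> \<mm> X\<^sub>2 \<alpha>\<^sub>2"
        using p \<alpha> by (auto simp: F)
      \<comment> \<open>A point over both counterexamples lies in neither preimage, hence not in
        their union.\<close>
      obtain z where "z \<in> FObj M Z" "g\<^sub>1 z = x\<^sub>1" "g\<^sub>2 z = x\<^sub>2"
        using is_product_Set_catD[OF preserves_product[OF prod, unfolded g1(1) g2(1)] x(1,2)] by blast
      with join x show False
        using p \<alpha> g1(2) g2(2) by (auto simp: F \<mm>_join src.Reidx_closed)
    qed
  next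
    fix T assume T: "is_terminal C T"
    then have "T \<in> Obj C" by (simp add: is_terminal_def)
    with preserves_terminal[OF T] show "\<bottom>\<^bsub>Fib P T\<^esub> \<notin> F T"
      by (auto simp: F \<mm>_bot is_terminal_Set_cat_iff)
  qed
qed


section \<open>Directed colimits of representable functors\<close>

text \<open>The arrows \<open>\<rho> s t\<close> run from the later stage to the earlier one, so
  that the sets \<open>Hom C (Z s) X\<close> grow covariantly with \<open>s\<close> and have a
  directed colimit.\<close>

locale directed_diagram = category C
  for C :: "('o, 'a) cat" +
  fixes D :: "'d::order set" and Z :: "'d \<Rightarrow> 'o" and \<rho> :: "'d \<Rightarrow> 'd \<Rightarrow> 'a"
  assumes nonempty: "D \<noteq> {}"
    and directed: "\<lbrakk>s \<in> D; t \<in> D\<rbrakk> \<Longrightarrow> \<exists>u\<in>D. s \<le> u \<and> t \<le> u"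
    and Z_Obj: "s \<in> D \<Longrightarrow> Z s \<in> Obj C"
    and \<rho>_in: "\<lbrakk>s \<in> D; t \<in> D; s \<le> t\<rbrakk> \<Longrightarrow> \<rho> s t \<in> Hom C (Z t) (Z s)"
    and \<rho>_refl: "s \<in> D \<Longrightarrow> \<rho> s s = Id C (Z s)"
    and \<rho>_trans: "\<lbrakk>s \<in> D; t \<in> D; u \<in> D; s \<le> t; t \<le> u\<rbrakk> \<Longrightarrow> Comp C (\<rho> s t) (\<rho> t u) = \<rho> s u"
begin

text \<open>Codomains are left free, so one set holds the representatives for the colimits at all
  objects, and a single coding serves all of them.\<close>

definition generalized_elements :: "('d \<times> 'a) set" where
  "generalized_elements = {(s, f). s \<in> D \<and> f \<in> Arr C \<and> Dom C f = Z s}"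

definition eventually_equal :: "(('d \<times> 'a) \<times> ('d \<times> 'a)) set" where
  "eventually_equal = {((s, f), (t, g)).
     (s, f) \<in> generalized_elements \<and> (t, g) \<in> generalized_elements \<and>
     (\<exists>u\<in>D. s \<le> u \<and> t \<le> u \<and> Comp C f (\<rho> s u) = Comp C g (\<rho> t u))}"

lemma generalized_elementsI: "\<lbrakk>s \<in> D; f \<in> Hom C (Z s) X\<rbrakk> \<Longrightarrow> (s, f) \<in> generalized_elements"
  by (auto simp: generalized_elements_def Hom_def)

lemma generalized_elementsE:
  assumes "(s, f) \<in> generalized_elements"
  shows "s \<in> D" "f \<in> Hom C (Z s) (Cod C f)"
  using assms by (auto simp: generalized_elements_def Hom_def)

lemma Comp_\<rho>_\<rho>:
  assumes "f \<in> Hom C (Z s) X" "s \<in> D" "t \<in> D" "u \<in> D" "s \<le> t" "t \<le> u"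
  shows "Comp C (Comp C f (\<rho> s t)) (\<rho> t u) = Comp C f (\<rho> s u)"
  using assms Comp_assoc[of "\<rho> t u" "Z u" "Z t" "\<rho> s t" "Z s" f X] \<rho>_in \<rho>_trans by simp

lemma equiv_eventually_equal: "equiv generalized_elements eventually_equal"
proof (rule equivI)
  show "eventually_equal \<subseteq> generalized_elements \<times> generalized_elements"
    by (auto simp: eventually_equal_def)
  show "refl_on generalized_elements eventually_equal"
    by (auto simp: refl_on_def eventually_equal_def generalized_elements_def)
  show "sym eventually_equal"
    by (rule symI) (auto simp: eventually_equal_def)
  show "trans eventually_equal"
  proof (rule transI)
    fix x y z assume "(x, y) \<in> eventually_equal" "(y, z) \<in> eventually_equal"
    then obtain s f t g r h u v where eqs: "x = (s, f)" "y = (t, g)" "z = (r, h)"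
      and el: "(s, f) \<in> generalized_elements" "(t, g) \<in> generalized_elements"
        "(r, h) \<in> generalized_elements"
      and u: "u \<in> D" "s \<le> u" "t \<le> u" "Comp C f (\<rho> s u) = Comp C g (\<rho> t u)"
      and v: "v \<in> D" "t \<le> v" "r \<le> v" "Comp C g (\<rho> t v) = Comp C h (\<rho> r v)"
      by (cases x; cases y; cases z) (auto simp: eventually_equal_def)
    \<comment> \<open>Directedness gives transitivity: both equalities persist at a stage above
      \<open>u\<close> and \<open>v\<close>, where they can be chained through
      \<open>g\<close>.\<close>
    obtain w where w: "w \<in> D" "u \<le> w" "v \<le> w" using directed[OF u(1) v(1)] by blast
    note e = generalized_elementsE[OF el(1)] generalized_elementsE[OF el(2)]
      generalized_elementsE[OF el(3)]
    have "Comp C f (\<rho> s w) = Comp C g (\<rho> t w)"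
      using Comp_\<rho>_\<rho>[OF e(2,1) u(1) w(1) u(2) w(2)] Comp_\<rho>_\<rho>[OF e(4,3) u(1) w(1) u(3) w(2)] u(4)
      by simp
    also have "\<dots> = Comp C h (\<rho> r w)"
      using Comp_\<rho>_\<rho>[OF e(4,3) v(1) w(1) v(2) w(3)] Comp_\<rho>_\<rho>[OF e(6,5) v(1) w(1) v(3) w(3)] v(4)
      by simp
    finally show "(x, z) \<in> eventually_equal"
      using el u(2) v(3) w unfolding eqs eventually_equal_def
      by (auto intro: order_trans)
  qed
qed

end

text \<open>
  The set \<open>colim X\<close> is the colimit of the sets \<open>Hom C (Z s) X\<close>; the map \<open>code\<close> sends a
  representative of an element of the colimit to a name of its class in the universe.
\<close>

locale coded_diagram = directed_diagram C D Z \<rho>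
  for C :: "('o, 'a) cat" and D :: "'d::order set" and Z \<rho> +
  fixes code :: "'d \<Rightarrow> 'a \<Rightarrow> 'u"
  assumes code_eq_iff: "\<lbrakk>(s, f) \<in> generalized_elements; (t, g) \<in> generalized_elements\<rbrakk>
    \<Longrightarrow> code s f = code t g \<longleftrightarrow> ((s, f), (t, g)) \<in> eventually_equal"
begin

lemma code_eqD:
  assumes "s \<in> D" "f \<in> Hom C (Z s) X" "t \<in> D" "g \<in> Hom C (Z t) Y" "code s f = code t g"
  shows "\<exists>u\<in>D. s \<le> u \<and> t \<le> u \<and> Comp C f (\<rho> s u) = Comp C g (\<rho> t u)"
  using assms code_eq_iff[OF generalized_elementsI generalized_elementsI]
  by (auto simp: eventually_equal_def)

lemma code_eqI:
  assumes "s \<in> D" "f \<in> Hom C (Z s) X" "t \<in> D" "g \<in> Hom C (Z t) Y"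
    and "u \<in> D" "s \<le> u" "t \<le> u" "Comp C f (\<rho> s u) = Comp C g (\<rho> t u)"
  shows "code s f = code t g"
  using assms code_eq_iff[OF generalized_elementsI generalized_elementsI, of s f X t g Y]
  by (auto simp: eventually_equal_def intro: generalized_elementsI)

text \<open>The witnessing stage is \<open>t\<close> itself, where restricting once more along
  \<open>\<rho> t t\<close> changes nothing. Representatives may thus be moved to later
  stages.\<close>

lemma code_restrict:
  assumes "s \<in> D" "t \<in> D" "s \<le> t" "f \<in> Hom C (Z s) X"
  shows "code t (Comp C f (\<rho> s t)) = code s f"
proof (rule code_eqI[where u = t])
  show "Comp C (Comp C f (\<rho> s t)) (\<rho> t t) = Comp C f (\<rho> s t)"
    using assms by (simp add: Comp_\<rho>_\<rho>)
  show "Comp C f (\<rho> s t) \<in> Hom C (Z t) X" using assms Comp_in \<rho>_in by blast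
qed (use assms in auto)

section \<open>The colimit as a finite-product-preserving functor into sets\<close>

definition colim :: "'o \<Rightarrow> 'u set" where
  "colim X = {code s f | s f. s \<in> D \<and> f \<in> Hom C (Z s) X}"

lemma colimI: "\<lbrakk>s \<in> D; f \<in> Hom C (Z s) X\<rbrakk> \<Longrightarrow> code s f \<in> colim X"
  by (auto simp: colim_def)

lemma colimE:
  assumes "x \<in> colim X"
  obtains s f where "s \<in> D" "f \<in> Hom C (Z s) X" "x = code s f"
  using assms by (auto simp: colim_def)

text \<open>Directedness lets two representatives be restricted to one stage; this is why the
  colimit commutes with finite products.\<close>

lemma colim_common_stage:
  assumes "x \<in> colim X" "y \<in> colim Y"
  obtains u f g where "u \<in> D" "f \<in> Hom C (Z u) X" "g \<in> Hom C (Z u) Y" "x = code u f" "y = code u g"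
proof -
  obtain s f where s: "s \<in> D" "f \<in> Hom C (Z s) X" "x = code s f" using assms(1) by (rule colimE)
  obtain t g where t: "t \<in> D" "g \<in> Hom C (Z t) Y" "y = code t g" using assms(2) by (rule colimE)
  obtain u where u: "u \<in> D" "s \<le> u" "t \<le> u" using directed s(1) t(1) by blast
  show thesis
    by (rule that[of u "Comp C f (\<rho> s u)" "Comp C g (\<rho> t u)"])
      (use s t u in \<open>auto simp: code_restrict intro: Comp_in \<rho>_in\<close>)
qed

text \<open>Restriction composes on the right and \<open>h\<close> on the left, so by associativity
  an agreement at stage \<open>u\<close> survives composition with \<open>h\<close>.\<close>

lemma code_Comp_cong:
  assumes s: "s \<in> D" "f \<in> Hom C (Z s) X" and t: "t \<in> D" "g \<in> Hom C (Z t) X"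
    and h: "h \<in> Hom C X Y" and eq: "code s f = code t g"
  shows "code s (Comp C h f) = code t (Comp C h g)"
proof -
  obtain u where u: "u \<in> D" "s \<le> u" "t \<le> u" "Comp C f (\<rho> s u) = Comp C g (\<rho> t u)"
    using code_eqD[OF s t eq] by blast
  show ?thesis
  proof (rule code_eqI[OF s(1) _ t(1) _ u(1,2,3)])
    show "Comp C h f \<in> Hom C (Z s) Y" "Comp C h g \<in> Hom C (Z t) Y"
      using s t h Comp_in by blast+
    show "Comp C (Comp C h f) (\<rho> s u) = Comp C (Comp C h g) (\<rho> t u)"
      using Comp_assoc[OF \<rho>_in[OF s(1) u(1,2)] s(2) h] Comp_assoc[OF \<rho>_in[OF t(1) u(1,3)] t(2) h] u(4)
      by simp
  qed
qed

text \<open>The value picked by \<open>SOME\<close> does not depend on the representative, by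
  \<open>code_Comp_cong\<close>. The function is restricted because arrows of \<open>Set_cat\<close>
  are extensional.\<close>

definition colim_map :: "'a \<Rightarrow> 'u \<Rightarrow> 'u" where
  "colim_map h = (\<lambda>x\<in>colim (Dom C h). SOME y.
     \<exists>s f. s \<in> D \<and> f \<in> Hom C (Z s) (Dom C h) \<and> x = code s f \<and> y = code s (Comp C h f))"

lemma colim_map_code:
  assumes s: "s \<in> D" "f \<in> Hom C (Z s) X" and h: "h \<in> Hom C X Y"
  shows "colim_map h (code s f) = code s (Comp C h f)"
proof -
  have X: "Dom C h = X" using h by (simp add: Hom_def)
  have "(SOME y. \<exists>t g. t \<in> D \<and> g \<in> Hom C (Z t) X \<and> code s f = code t g \<and> y = code t (Comp C h g))
      = code s (Comp C h f)"
    by (rule some_equality) (use s h in blast, use s h code_Comp_cong in metis)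
  then show ?thesis using s by (simp add: colim_map_def X colimI)
qed

lemma colim_map_in:
  assumes h: "h \<in> Hom C X Y"
  shows "colim_map h \<in> colim X \<rightarrow>\<^sub>E colim Y"
proof (rule PiE_I)
  fix x assume "x \<in> colim X"
  then obtain s f where s: "s \<in> D" "f \<in> Hom C (Z s) X" "x = code s f" by (rule colimE)
  then show "colim_map h x \<in> colim Y"
    using h by (auto simp: colim_map_code intro!: colimI Comp_in)
next
  fix x assume "x \<notin> colim X"
  then show "colim_map h x = undefined" using h by (simp add: colim_map_def Hom_def)
qed

definition colim_functor :: "('o, 'a, 'u set, 'u set_arr) func" where
  "colim_functor = \<lparr>FObj = colim, FArr = (\<lambda>h. (colim (Dom C h), colim_map h, colim (Cod C h)))\<rparr>"

lemma colim_functor_simps: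
  "FObj colim_functor = colim"
  "h \<in> Hom C X Y \<Longrightarrow> FArr colim_functor h = (colim X, colim_map h, colim Y)"
  by (auto simp: colim_functor_def Hom_def)

lemma colim_is_functor: "cat_functor C Set_cat colim_functor"
proof -
  interpret Set: category "Set_cat :: ('u set, 'u set_arr) cat" by (rule Set_cat_category)
  show ?thesis
  proof
    fix X show "FObj colim_functor X \<in> Obj Set_cat" by (simp add: Set_cat_simps)
  next
    fix f X Y assume "f \<in> Hom C X Y"
    then show "FArr colim_functor f \<in> Hom Set_cat (FObj colim_functor X) (FObj colim_functor Y)"
      using colim_map_in by (auto simp: colim_functor_simps Hom_Set_cat)
  next
    fix X assume X: "X \<in> Obj C"
    have "colim_map (Id C X) x = restrict id (colim X) x" for x
    proof (cases "x \<in> colim X")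
      case True
      then obtain s f where s: "s \<in> D" "f \<in> Hom C (Z s) X" "x = code s f" by (rule colimE)
      then show ?thesis
        using True colim_map_code[OF s(1,2) Id_in[OF X]] Comp_Id_left[OF s(2)] by simp
    next
      case False
      then show ?thesis using PiE_arb[OF colim_map_in[OF Id_in[OF X]]] by simp
    qed
    then show "FArr colim_functor (Id C X) = Id Set_cat (FObj colim_functor X)"
      using Id_in[OF X] by (auto simp: colim_functor_simps Set_cat_simps)
  next
    fix f X Y g W
    assume f: "f \<in> Hom C X Y" and g: "g \<in> Hom C Y W"
    note gf = Comp_in[OF f g]
    have "colim_map (Comp C g f) x = compose (colim X) (colim_map g) (colim_map f) x" for x
    proof (cases "x \<in> colim X")
      case True
      then obtain s h where s: "s \<in> D" "h \<in> Hom C (Z s) X" "x = code s h" by (rule colimE)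
      then show ?thesis
        using True colim_map_code[OF s(1,2) gf] colim_map_code[OF s(1,2) f]
          colim_map_code[OF s(1) Comp_in[OF s(2) f] g] Comp_assoc[OF s(2) f g]
        by (simp add: compose_def)
    next
      case False
      then show ?thesis using PiE_arb[OF colim_map_in[OF gf]] by (simp add: compose_def)
    qed
    then show "FArr colim_functor (Comp C g f) =
        Comp Set_cat (FArr colim_functor g) (FArr colim_functor f)"
      using f g gf by (auto simp: colim_functor_simps Set_cat_simps)
  qed
qed

text \<open>Any stage supplies an element through its arrow to \<open>T\<close>; two elements have
  representatives at one stage, where arrows to \<open>T\<close> coincide.\<close>

lemma colim_preserves_terminal:
  assumes T: "is_terminal C T"
  shows "is_terminal Set_cat (colim T)"
proof -
  obtain s where s: "s \<in> D" using nonempty by blast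
  then obtain f where "f \<in> Hom C (Z s) T" using T Z_Obj unfolding is_terminal_def by blast
  then have "code s f \<in> colim T" using s by (rule colimI[rotated])
  moreover have "x = y" if xy: "x \<in> colim T" "y \<in> colim T" for x y
  proof -
    from xy obtain u f g where "u \<in> D" "f \<in> Hom C (Z u) T" "g \<in> Hom C (Z u) T"
      "x = code u f" "y = code u g" by (rule colim_common_stage)
    then show ?thesis using T Z_Obj unfolding is_terminal_def by metis
  qed
  ultimately show ?thesis unfolding is_terminal_Set_cat_iff by blast
qed

text \<open>For existence, two elements are brought to one stage and paired there. For uniqueness,
  both projections of the two representatives agree at some later stage, where the universal
  property of \<open>W\<close> identifies them.\<close>

lemma colim_preserves_product:
  assumes prod: "is_product C X Y W p q"
  shows "is_product Set_cat (colim X) (colim Y) (colim W)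
    (colim W, colim_map p, colim X) (colim W, colim_map q, colim Y)"
proof (rule is_product_Set_catI)
  have p: "p \<in> Hom C W X" and q: "q \<in> Hom C W Y"
    and univ: "\<And>V f g. \<lbrakk>V \<in> Obj C; f \<in> Hom C V X; g \<in> Hom C V Y\<rbrakk>
      \<Longrightarrow> \<exists>!h. h \<in> Hom C V W \<and> Comp C p h = f \<and> Comp C q h = g"
    using prod unfolding is_product_def by auto
  show "colim_map p \<in> colim W \<rightarrow>\<^sub>E colim X" "colim_map q \<in> colim W \<rightarrow>\<^sub>E colim Y"
    by (rule colim_map_in[OF p], rule colim_map_in[OF q])
  fix a b assume "a \<in> colim X" "b \<in> colim Y"
  then obtain u f g where u: "u \<in> D" "f \<in> Hom C (Z u) X" "g \<in> Hom C (Z u) Y"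
    "a = code u f" "b = code u g" by (rule colim_common_stage)
  then obtain h where "h \<in> Hom C (Z u) W" "Comp C p h = f" "Comp C q h = g"
    using univ[OF Z_Obj] by blast
  with u show "\<exists>z\<in>colim W. colim_map p z = a \<and> colim_map q z = b"
    by (intro bexI[of _ "code u h"]) (auto simp: colim_map_code[OF _ _ p] colim_map_code[OF _ _ q] intro: colimI)
next
  have p: "p \<in> Hom C W X" and q: "q \<in> Hom C W Y"
    and univ: "\<And>V f g. \<lbrakk>V \<in> Obj C; f \<in> Hom C V X; g \<in> Hom C V Y\<rbrakk>
      \<Longrightarrow> \<exists>!h. h \<in> Hom C V W \<and> Comp C p h = f \<and> Comp C q h = g"
    using prod unfolding is_product_def by auto
  fix z z' assume z: "z \<in> colim W" "z' \<in> colim W"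
    and eq: "colim_map p z = colim_map p z'" "colim_map q z = colim_map q z'"
  from z obtain u h h' where u: "u \<in> D" and h: "h \<in> Hom C (Z u) W" and h': "h' \<in> Hom C (Z u) W"
    and zz: "z = code u h" "z' = code u h'" by (rule colim_common_stage)
  \<comment> \<open>Agreement is stated for all stages beyond \<open>v\<close>, so that the bounds
    found for \<open>p\<close> and for \<open>q\<close> can be combined.\<close>
  have stage: "\<exists>v\<in>D. u \<le> v \<and> (\<forall>w\<in>D. v \<le> w \<longrightarrow>
      Comp C k (Comp C h (\<rho> u w)) = Comp C k (Comp C h' (\<rho> u w)))"
    if k: "k \<in> Hom C W V" and eq: "colim_map k z = colim_map k z'" for k V
  proof -
    note kh = Comp_in[OF h k] Comp_in[OF h' k]
    obtain v where v: "v \<in> D" "u \<le> v" "Comp C (Comp C k h) (\<rho> u v) = Comp C (Comp C k h') (\<rho> u v)"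
      using eq code_eqD[OF u kh(1) u kh(2)]
      unfolding zz colim_map_code[OF u h k] colim_map_code[OF u h' k] by blast
    have "Comp C k (Comp C h (\<rho> u w)) = Comp C k (Comp C h' (\<rho> u w))" if w: "w \<in> D" "v \<le> w" for w
    proof -
      have uw: "u \<le> w" using v(2) w(2) by simp
      show ?thesis
        using Comp_\<rho>_\<rho>[OF kh(1) u v(1) w(1) v(2) w(2)] Comp_\<rho>_\<rho>[OF kh(2) u v(1) w(1) v(2) w(2)] v(3)
          Comp_assoc[OF \<rho>_in[OF u w(1) uw] h k] Comp_assoc[OF \<rho>_in[OF u w(1) uw] h' k]
        by simp
    qed
    with v show ?thesis by blast
  qed
  obtain v where v: "v \<in> D" "u \<le> v" "\<forall>w\<in>D. v \<le> w \<longrightarrow>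
      Comp C p (Comp C h (\<rho> u w)) = Comp C p (Comp C h' (\<rho> u w))"
    using stage[OF p eq(1)] by blast
  obtain v' where v': "v' \<in> D" "\<forall>w\<in>D. v' \<le> w \<longrightarrow>
      Comp C q (Comp C h (\<rho> u w)) = Comp C q (Comp C h' (\<rho> u w))"
    using stage[OF q eq(2)] by blast
  obtain w where w: "w \<in> D" "v \<le> w" "v' \<le> w" using directed v(1) v'(1) by blast
  then have uw: "u \<le> w" using v(2) by simp
  let ?k = "Comp C h (\<rho> u w)" and ?k' = "Comp C h' (\<rho> u w)"
  have k: "?k \<in> Hom C (Z w) W" "?k' \<in> Hom C (Z w) W"
    using Comp_in \<rho>_in[OF u w(1) uw] h h' by blast+
  have "?k = ?k'"
    using univ[OF Z_Obj[OF w(1)] Comp_in[OF k(1) p] Comp_in[OF k(1) q]] k v(3) v'(2) w by metis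
  then show "z = z'"
    unfolding zz using code_restrict[OF u w(1) uw h] code_restrict[OF u w(1) uw h'] by simp
qed

lemma colim_fp_functor: "fp_functor C Set_cat colim_functor"
proof -
  interpret cat_functor C Set_cat colim_functor by (rule colim_is_functor)
  show ?thesis
  proof
    fix T assume "is_terminal C T"
    then show "is_terminal Set_cat (FObj colim_functor T)"
      by (simp add: colim_functor_simps colim_preserves_terminal)
  next
    fix X Y W p q assume prod: "is_product C X Y W p q"
    then have "p \<in> Hom C W X" "q \<in> Hom C W Y" by (auto simp: is_product_def)
    with colim_preserves_product[OF prod]
    show "is_product Set_cat (FObj colim_functor X) (FObj colim_functor Y) (FObj colim_functor W)
        (FArr colim_functor p) (FArr colim_functor q)"
      by (simp add: colim_functor_simps)
  qed
qed

end


text \<open>The quotient is an image of \<open>A\<close>, hence no larger; the code of an element is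
  the image of its class under an injection into the universe.\<close>

lemma ex_class_code:
  assumes equiv: "equiv A r" and small: "A \<lesssim> (UNIV :: 'u set)"
  shows "\<exists>c :: 'x \<Rightarrow> 'u. \<forall>x\<in>A. \<forall>y\<in>A. c x = c y \<longleftrightarrow> (x, y) \<in> r"
proof -
  have "A // r \<lesssim> A"
    by (rule subset_image_lepoll[of _ "\<lambda>x. r `` {x}"]) (auto simp: quotient_def)
  from lepoll_trans[OF this small] obtain e :: "'x set \<Rightarrow> 'u" where e: "inj_on e (A // r)"
    by (auto simp: lepoll_def)
  have "e (r `` {x}) = e (r `` {y}) \<longleftrightarrow> (x, y) \<in> r" if "x \<in> A" "y \<in> A" for x y
    using that e eq_equiv_class_iff[OF equiv that] by (simp add: inj_on_eq_iff quotientI)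
  then show ?thesis by (intro exI[of _ "\<lambda>x. e (r `` {x})"]) blast
qed


section \<open>Coherent families of filters\<close>

locale doctrine_diagram = boolean_doctrine C P + directed_diagram C D Z \<rho>
  for C :: "('o, 'a) cat" and P :: "('o, 'a, 'p) doctrine" and D :: "'d::order set" and Z \<rho>
begin

abbreviation fib :: "'d \<Rightarrow> 'p gorder" where
  "fib s \<equiv> Fib P (Z s)"

lemma fib_boolean: "s \<in> D \<Longrightarrow> boolean_alg (fib s)"
  by (intro Fib_boolean Z_Obj)

lemma Reidx_\<rho>_trans:
  assumes "s \<in> D" "t \<in> D" "u \<in> D" "s \<le> t" "t \<le> u" "\<alpha> \<in> carrier (fib s)"
  shows "Reidx P (\<rho> t u) (Reidx P (\<rho> s t) \<alpha>) = Reidx P (\<rho> s u) \<alpha>"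
  using Reidx_Comp[of "\<rho> t u" "Z u" "Z t" "\<rho> s t" "Z s" \<alpha>] assms \<rho>_in \<rho>_trans by simp

text \<open>Presents a proper filter on the directed colimit of the algebras \<open>fib s\<close>
  without forming that colimit.\<close>

definition coherent :: "('d \<Rightarrow> 'p set) \<Rightarrow> bool" where
  "coherent G \<longleftrightarrow>
     (\<forall>s\<in>D. lattice_filter (fib s) (G s) \<and> \<bottom>\<^bsub>fib s\<^esub> \<notin> G s) \<and>
     (\<forall>s\<in>D. \<forall>t\<in>D. s \<le> t \<longrightarrow> (\<forall>\<alpha>\<in>G s. Reidx P (\<rho> s t) \<alpha> \<in> G t))"

lemma
  assumes "coherent G"
  shows coherent_filter: "s \<in> D \<Longrightarrow> lattice_filter (fib s) (G s)"
    and coherent_proper: "s \<in> D \<Longrightarrow> \<bottom>\<^bsub>fib s\<^esub> \<notin> G s"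
    and coherent_Reidx: "\<lbrakk>s \<in> D; t \<in> D; s \<le> t; \<alpha> \<in> G s\<rbrakk> \<Longrightarrow> Reidx P (\<rho> s t) \<alpha> \<in> G t"
  using assms unfolding coherent_def by blast+

text \<open>The usual adjunction of one element to a filter: everything above a meet of \<alpha>
  with an element of \<open>G\<close> is added. Since \<alpha> lives at stage \<open>s\<close>, such
  comparisons take place at stages above \<open>s\<close>.\<close>

lemma coherent_extend:
  assumes G: "coherent G" and s: "s \<in> D" and \<alpha>: "\<alpha> \<in> carrier (fib s)"
    and compatible: "\<And>u \<gamma>. \<lbrakk>u \<in> D; s \<le> u; \<gamma> \<in> G u\<rbrakk>
      \<Longrightarrow> \<gamma> \<sqinter>\<^bsub>fib u\<^esub> Reidx P (\<rho> s u) \<alpha> \<noteq> \<bottom>\<^bsub>fib u\<^esub>"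
  shows "\<exists>G'. coherent G' \<and> (\<forall>t\<in>D. G t \<subseteq> G' t) \<and> \<alpha> \<in> G' s"
proof -
  \<comment> \<open>The pair \<open>(u, \<gamma>)\<close> witnesses, at a later stage \<open>u\<close>, that \<open>\<beta>\<close> follows from \<open>G\<close> and \<open>\<alpha>\<close>.\<close>
  define below where "below t \<beta> u \<gamma> \<longleftrightarrow> u \<in> D \<and> t \<le> u \<and> s \<le> u \<and> \<gamma> \<in> G u \<and>
      \<gamma> \<sqinter>\<^bsub>fib u\<^esub> Reidx P (\<rho> s u) \<alpha> \<sqsubseteq>\<^bsub>fib u\<^esub> Reidx P (\<rho> t u) \<beta>" for t \<beta> u \<gamma>
  define G' where "G' t = {\<beta> \<in> carrier (fib t). \<exists>u \<gamma>. below t \<beta> u \<gamma>}" for t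
  \<comment> \<open>Witnesses survive at later stages, so two of them can be moved to a common
    stage.\<close>
  have push: "below t \<beta> v (Reidx P (\<rho> u v) \<gamma>)"
    if b: "below t \<beta> u \<gamma>" and t: "t \<in> D" "\<beta> \<in> carrier (fib t)" and v: "v \<in> D" "u \<le> v" for t \<beta> u v \<gamma>
  proof -
    have u: "u \<in> D" "t \<le> u" "s \<le> u" "\<gamma> \<in> G u"
      and le: "\<gamma> \<sqinter>\<^bsub>fib u\<^esub> Reidx P (\<rho> s u) \<alpha> \<sqsubseteq>\<^bsub>fib u\<^esub> Reidx P (\<rho> t u) \<beta>"
      using b by (auto simp: below_def)
    interpret u: boolean_alg "fib u" by (rule fib_boolean[OF u(1)])
    have uv: "\<rho> u v \<in> Hom C (Z v) (Z u)" using u v by (intro \<rho>_in)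
    have c: "\<gamma> \<in> carrier (fib u)" "Reidx P (\<rho> s u) \<alpha> \<in> carrier (fib u)"
      "Reidx P (\<rho> t u) \<beta> \<in> carrier (fib u)"
      using lattice_filter_carrier[OF coherent_filter[OF G u(1)] u(4)]
        Reidx_closed[OF \<rho>_in[OF s u(1,3)] \<alpha>] Reidx_closed[OF \<rho>_in[OF t(1) u(1,2)] t(2)] by auto
    have "Reidx P (\<rho> u v) \<gamma> \<sqinter>\<^bsub>fib v\<^esub> Reidx P (\<rho> s v) \<alpha> \<sqsubseteq>\<^bsub>fib v\<^esub> Reidx P (\<rho> t v) \<beta>"
      using Reidx_mono[OF uv le u.meet_closed[OF c(1,2)] c(3)] Reidx_meet[OF uv c(1,2)]
        Reidx_\<rho>_trans[OF s u(1) v(1) u(3) v(2) \<alpha>] Reidx_\<rho>_trans[OF t(1) u(1) v(1) u(2) v(2) t(2)]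
      by simp
    then show ?thesis
      using u v coherent_Reidx[OF G u(1) v u(4)] by (auto simp: below_def)
  qed
  have sub: "G t \<subseteq> G' t" if t: "t \<in> D" for t
  proof
    fix \<beta> assume \<beta>: "\<beta> \<in> G t"
    then have \<beta>c: "\<beta> \<in> carrier (fib t)" using lattice_filter_carrier[OF coherent_filter[OF G t]] by simp
    obtain u where u: "u \<in> D" "t \<le> u" "s \<le> u" using directed t s by blast
    interpret u: boolean_alg "fib u" by (rule fib_boolean[OF u(1)])
    have "below t \<beta> u (Reidx P (\<rho> t u) \<beta>)"
      using u coherent_Reidx[OF G t u(1,2) \<beta>] Reidx_closed[OF \<rho>_in[OF t u(1,2)] \<beta>c]
        Reidx_closed[OF \<rho>_in[OF s u(1,3)] \<alpha>]
      by (auto simp: below_def intro: u.meet_left)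
    then show "\<beta> \<in> G' t" using \<beta>c by (auto simp: G'_def)
  qed
  have "\<alpha> \<in> G' s"
  proof -
    interpret s: boolean_alg "fib s" by (rule fib_boolean[OF s])
    have "\<top>\<^bsub>fib s\<^esub> \<in> G s" using s.lattice_filter_top[OF coherent_filter[OF G s]] .
    \<comment> \<open>Stage \<open>s\<close> itself serves, with the top element as the member of
      \<open>G\<close>.\<close>
    then have "below s \<alpha> s \<top>\<^bsub>fib s\<^esub>"
      using s \<alpha> Reidx_closed[OF \<rho>_in[OF s s order_refl] \<alpha>] by (auto simp: below_def intro: s.meet_right)
    then show ?thesis using \<alpha> by (auto simp: G'_def)
  qed
  moreover have "coherent G'"
    unfolding coherent_def
  proof (intro conjI ballI impI)
    fix t assume t: "t \<in> D"
    interpret t: boolean_alg "fib t" by (rule fib_boolean[OF t])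
    show "lattice_filter (fib t) (G' t)"
      unfolding lattice_filter_def
    proof (intro conjI ballI impI)
      show "G' t \<subseteq> carrier (fib t)" by (auto simp: G'_def)
      show "G' t \<noteq> {}" using sub[OF t] t.lattice_filter_top[OF coherent_filter[OF G t]] by blast
    next
      fix \<beta> \<beta>' assume "\<beta> \<in> G' t" "\<beta>' \<in> G' t"
      then obtain u u' \<gamma> \<gamma>' where b: "below t \<beta> u \<gamma>" "below t \<beta>' u' \<gamma>'"
        and \<beta>: "\<beta> \<in> carrier (fib t)" "\<beta>' \<in> carrier (fib t)"
        by (auto simp: G'_def)
      then have "u \<in> D" "u' \<in> D" by (auto simp: below_def)
      then obtain v where v: "v \<in> D" "u \<le> v" "u' \<le> v" using directed by blast
      define \<delta> where "\<delta> = Reidx P (\<rho> u v) \<gamma>"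
      define \<delta>' where "\<delta>' = Reidx P (\<rho> u' v) \<gamma>'"
      have d: "below t \<beta> v \<delta>" "below t \<beta>' v \<delta>'"
        using push[OF b(1) t \<beta>(1) v(1,2)] push[OF b(2) t \<beta>(2) v(1,3)] by (auto simp: \<delta>_def \<delta>'_def)
      then have tv: "t \<le> v" "s \<le> v" and dG: "\<delta> \<in> G v" "\<delta>' \<in> G v" by (auto simp: below_def)
      interpret v: boolean_alg "fib v" by (rule fib_boolean[OF v(1)])
      note vt = \<rho>_in[OF t v(1) tv(1)]
      let ?a = "Reidx P (\<rho> s v) \<alpha>"
      have c: "\<delta> \<in> carrier (fib v)" "\<delta>' \<in> carrier (fib v)" "?a \<in> carrier (fib v)"
        "Reidx P (\<rho> t v) \<beta> \<in> carrier (fib v)" "Reidx P (\<rho> t v) \<beta>' \<in> carrier (fib v)"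
        using dG lattice_filter_carrier[OF coherent_filter[OF G v(1)]] \<beta> Reidx_closed[OF vt]
          Reidx_closed[OF \<rho>_in[OF s v(1) tv(2)] \<alpha>] by auto
      have "(\<delta> \<sqinter>\<^bsub>fib v\<^esub> \<delta>') \<sqinter>\<^bsub>fib v\<^esub> ?a \<sqsubseteq>\<^bsub>fib v\<^esub> Reidx P (\<rho> t v) \<beta>"
        using d(1) c
        by (intro v.le_trans[OF v.meet_mono[OF v.meet_left v.le_refl]]) (auto simp: below_def)
      moreover have "(\<delta> \<sqinter>\<^bsub>fib v\<^esub> \<delta>') \<sqinter>\<^bsub>fib v\<^esub> ?a \<sqsubseteq>\<^bsub>fib v\<^esub> Reidx P (\<rho> t v) \<beta>'"
        using d(2) c
        by (intro v.le_trans[OF v.meet_mono[OF v.meet_right v.le_refl]]) (auto simp: below_def)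
      ultimately have "below t (\<beta> \<sqinter>\<^bsub>fib t\<^esub> \<beta>') v (\<delta> \<sqinter>\<^bsub>fib v\<^esub> \<delta>')"
        using v(1) tv c lattice_filter_meet[OF coherent_filter[OF G v(1)] dG] Reidx_meet[OF vt \<beta>]
        by (auto simp: below_def intro: v.meet_le)
      then show "\<beta> \<sqinter>\<^bsub>fib t\<^esub> \<beta>' \<in> G' t" using \<beta> by (auto simp: G'_def)
    next
      fix \<beta> \<beta>' assume "\<beta> \<in> G' t" and \<beta>': "\<beta>' \<in> carrier (fib t)" and le: "\<beta> \<sqsubseteq>\<^bsub>fib t\<^esub> \<beta>'"
      then obtain u \<gamma> where b: "below t \<beta> u \<gamma>" and \<beta>: "\<beta> \<in> carrier (fib t)" by (auto simp: G'_def)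
      then have u: "u \<in> D" "t \<le> u" "s \<le> u" "\<gamma> \<in> G u" by (auto simp: below_def)
      interpret u: boolean_alg "fib u" by (rule fib_boolean[OF u(1)])
      note ut = \<rho>_in[OF t u(1,2)]
      have c: "\<gamma> \<sqinter>\<^bsub>fib u\<^esub> Reidx P (\<rho> s u) \<alpha> \<in> carrier (fib u)"
        using lattice_filter_carrier[OF coherent_filter[OF G u(1)] u(4)]
          Reidx_closed[OF \<rho>_in[OF s u(1,3)] \<alpha>] by simp
      have "below t \<beta>' u \<gamma>"
        using b u.le_trans[OF _ Reidx_mono[OF ut le \<beta> \<beta>'] c Reidx_closed[OF ut \<beta>] Reidx_closed[OF ut \<beta>']]
        by (auto simp: below_def)
      then show "\<beta>' \<in> G' t" using \<beta>' by (auto simp: G'_def)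
    qed
    show "\<bottom>\<^bsub>fib t\<^esub> \<notin> G' t"
    proof
      assume "\<bottom>\<^bsub>fib t\<^esub> \<in> G' t"
      then obtain u \<gamma> where b: "below t \<bottom>\<^bsub>fib t\<^esub> u \<gamma>" by (auto simp: G'_def)
      then have u: "u \<in> D" "t \<le> u" "s \<le> u" "\<gamma> \<in> G u" by (auto simp: below_def)
      interpret u: boolean_alg "fib u" by (rule fib_boolean[OF u(1)])
      let ?m = "\<gamma> \<sqinter>\<^bsub>fib u\<^esub> Reidx P (\<rho> s u) \<alpha>"
      have c: "?m \<in> carrier (fib u)"
        using lattice_filter_carrier[OF coherent_filter[OF G u(1)] u(4)]
          Reidx_closed[OF \<rho>_in[OF s u(1,3)] \<alpha>] by simp
      \<comment> \<open>A witness for bottom would be a member of \<open>G\<close> disjoint from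
        \<alpha>, which \<open>compatible\<close> forbids.\<close>
      have "?m \<sqsubseteq>\<^bsub>fib u\<^esub> \<bottom>\<^bsub>fib u\<^esub>"
        using b Reidx_bottom[OF \<rho>_in[OF t u(1,2)]] by (simp add: below_def)
      then have "?m = \<bottom>\<^bsub>fib u\<^esub>" using c by (intro u.le_antisym) auto
      with compatible[OF u(1,3,4)] show False by simp
    qed
  next
    fix t r \<beta> assume t: "t \<in> D" "r \<in> D" "t \<le> r" and "\<beta> \<in> G' t"
    then obtain u \<gamma> where b: "below t \<beta> u \<gamma>" and \<beta>: "\<beta> \<in> carrier (fib t)" by (auto simp: G'_def)
    then have "u \<in> D" by (simp add: below_def)
    then obtain v where v: "v \<in> D" "u \<le> v" "r \<le> v" using directed t(2) by blast
    have "below r (Reidx P (\<rho> t r) \<beta>) v (Reidx P (\<rho> u v) \<gamma>)"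
      using push[OF b t(1) \<beta> v(1,2)] v Reidx_\<rho>_trans[OF t(1,2) v(1) t(3) v(3) \<beta>]
      by (simp add: below_def)
    then show "Reidx P (\<rho> t r) \<beta> \<in> G' r"
      using Reidx_closed[OF \<rho>_in[OF t] \<beta>] by (auto simp: G'_def)
  qed
  ultimately show ?thesis using sub by blast
qed

text \<open>The chain condition of Zorn's lemma. Only closure under meets involves two members, and
  comparability places both in one family of the chain.\<close>

lemma coherent_Union_chain:
  assumes "\<C> \<noteq> {}" and chain: "\<And>A B. A \<in> \<C> \<Longrightarrow> B \<in> \<C> \<Longrightarrow> A \<subseteq> B \<or> B \<subseteq> A"
    and coh: "\<And>A. A \<in> \<C> \<Longrightarrow> coherent (\<lambda>s. A `` {s})"
  shows "coherent (\<lambda>s. \<Union>\<C> `` {s})"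
  unfolding coherent_def
proof (intro conjI ballI impI)
  fix s assume s: "s \<in> D"
  show "lattice_filter (fib s) (\<Union>\<C> `` {s})"
    unfolding lattice_filter_def
  proof (intro conjI ballI impI)
    show "\<Union>\<C> `` {s} \<subseteq> carrier (fib s)"
      using coherent_filter[OF coh s] unfolding lattice_filter_def by fast
    obtain A where "A \<in> \<C>" using \<open>\<C> \<noteq> {}\<close> by blast
    then show "\<Union>\<C> `` {s} \<noteq> {}"
      using coherent_filter[OF coh s] unfolding lattice_filter_def by blast
  next
    fix x y assume "x \<in> \<Union>\<C> `` {s}" "y \<in> \<Union>\<C> `` {s}"
    then obtain A B where "A \<in> \<C>" "B \<in> \<C>" "(s, x) \<in> A" "(s, y) \<in> B" by auto
    then obtain A where A: "A \<in> \<C>" "(s, x) \<in> A" "(s, y) \<in> A" using chain[of A B] by blast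
    then show "x \<sqinter>\<^bsub>fib s\<^esub> y \<in> \<Union>\<C> `` {s}"
      using lattice_filter_meet[OF coherent_filter[OF coh[OF A(1)] s], of x y] by blast
  next
    fix x y assume "x \<in> \<Union>\<C> `` {s}" "y \<in> carrier (fib s)" "x \<sqsubseteq>\<^bsub>fib s\<^esub> y"
    then show "y \<in> \<Union>\<C> `` {s}"
      using lattice_filter_up[OF coherent_filter[OF coh s], of _ x y] by blast
  qed
  show "\<bottom>\<^bsub>fib s\<^esub> \<notin> \<Union>\<C> `` {s}"
    using coherent_proper[OF coh s] by blast
next
  fix s t \<alpha> assume "s \<in> D" "t \<in> D" "s \<le> t" "\<alpha> \<in> \<Union>\<C> `` {s}"
  then show "Reidx P (\<rho> s t) \<alpha> \<in> \<Union>\<C> `` {t}"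
    using coherent_Reidx[OF coh, of _ s t \<alpha>] by blast
qed

text \<open>In a maximal coherent family, an undecided \<alpha> would be disjoint from one member
  and its complement from another. At a common later stage the first member lies below the
  complement, so the complement belongs to the family, and its meet with the second member is
  bottom.\<close>

lemma coherent_ultrafilters:
  assumes G: "coherent G"
  shows "\<exists>U. coherent U \<and> (\<forall>s\<in>D. G s \<subseteq> U s \<and> ultrafilter (fib s) (U s))"
proof -
  \<comment> \<open>Families are coded as relations, so that pointwise inclusion becomes set
    inclusion. Confining them to stages in \<open>D\<close> lets a maximal one be recovered as
    \<open>Sigma D U\<close>.\<close>
  define \<A> where "\<A> = {A. A \<subseteq> Sigma D (\<lambda>s. carrier (fib s)) \<and> Sigma D G \<subseteq> A \<and> coherent (\<lambda>s. A `` {s})}"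
  have Sigma_in: "Sigma D H \<in> \<A>" if H: "coherent H" "\<And>s. s \<in> D \<Longrightarrow> G s \<subseteq> H s" for H
  proof -
    have "coherent (\<lambda>s. Sigma D H `` {s})" using H(1) unfolding coherent_def by (simp add: Sigma_Image)
    moreover have "H s \<subseteq> carrier (fib s)" if "s \<in> D" for s
      using coherent_filter[OF H(1) that] by (auto simp: lattice_filter_def)
    ultimately show ?thesis using H(2) unfolding \<A>_def by blast
  qed
  have "\<exists>A\<in>\<A>. \<forall>B\<in>\<A>. A \<subseteq> B \<longrightarrow> B = A"
  proof (rule subset_Zorn_nonempty)
    show "\<A> \<noteq> {}" using Sigma_in[OF G] by blast
    fix \<C> assume ne: "\<C> \<noteq> {}" and chain: "subset.chain \<A> \<C>"
    then have sub: "\<C> \<subseteq> \<A>" and lin: "\<And>A B. A \<in> \<C> \<Longrightarrow> B \<in> \<C> \<Longrightarrow> A \<subseteq> B \<or> B \<subseteq> A"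
      by (auto simp: subset_chain_def)
    have "coherent (\<lambda>s. \<Union>\<C> `` {s})"
      using coherent_Union_chain[OF ne lin] sub by (auto simp: \<A>_def)
    with ne sub show "\<Union>\<C> \<in> \<A>" unfolding \<A>_def by blast
  qed
  then obtain A where A: "A \<in> \<A>" and max: "\<And>B. B \<in> \<A> \<Longrightarrow> A \<subseteq> B \<Longrightarrow> B = A" by blast
  define U where "U s = A `` {s}" for s
  have U: "coherent U" and GU: "\<And>s. s \<in> D \<Longrightarrow> G s \<subseteq> U s" and A_Sigma: "A = Sigma D U"
    using A unfolding \<A>_def U_def by auto
  \<comment> \<open>Maximality as a membership test: an element that could be adjoined coherently
    already belongs to \<open>U\<close>.\<close>
  have compat: "\<alpha> \<in> U s"
    if s: "s \<in> D" "\<alpha> \<in> carrier (fib s)" and c: "\<And>u \<gamma>. \<lbrakk>u \<in> D; s \<le> u; \<gamma> \<in> U u\<rbrakk>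
      \<Longrightarrow> \<gamma> \<sqinter>\<^bsub>fib u\<^esub> Reidx P (\<rho> s u) \<alpha> \<noteq> \<bottom>\<^bsub>fib u\<^esub>" for s \<alpha>
  proof -
    obtain H where H: "coherent H" "\<forall>t\<in>D. U t \<subseteq> H t" "\<alpha> \<in> H s"
      using coherent_extend[OF U s c] by blast
    have "Sigma D H \<in> \<A>" using H GU by (intro Sigma_in) auto
    then have "Sigma D H = A" using H(2) by (intro max) (auto simp: A_Sigma)
    then show ?thesis using s(1) H(3) by (auto simp: U_def)
  qed
  have "\<alpha> \<in> U s \<or> compl (fib s) \<alpha> \<in> U s" if s: "s \<in> D" and \<alpha>: "\<alpha> \<in> carrier (fib s)" for s \<alpha>
  proof (rule ccontr)
    interpret s: boolean_alg "fib s" by (rule fib_boolean[OF s])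
    assume "\<not> (\<alpha> \<in> U s \<or> compl (fib s) \<alpha> \<in> U s)"
    then obtain u \<gamma> v \<delta> where
      u: "u \<in> D" "s \<le> u" "\<gamma> \<in> U u" "\<gamma> \<sqinter>\<^bsub>fib u\<^esub> Reidx P (\<rho> s u) \<alpha> = \<bottom>\<^bsub>fib u\<^esub>" and
      v: "v \<in> D" "s \<le> v" "\<delta> \<in> U v" "\<delta> \<sqinter>\<^bsub>fib v\<^esub> Reidx P (\<rho> s v) (compl (fib s) \<alpha>) = \<bottom>\<^bsub>fib v\<^esub>"
      using compat[OF s \<alpha>] compat[OF s s.compl_closed[OF \<alpha>]] by blast
    obtain w where w: "w \<in> D" "u \<le> w" "v \<le> w" using directed u(1) v(1) by blast
    interpret w: boolean_alg "fib w" by (rule fib_boolean[OF w(1)])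
    note sw = order_trans[OF u(2) w(2)]
    note filter = coherent_filter[OF U]
    \<comment> \<open>Reindexing preserves meets and bottom, so both disjointness witnesses can be
      transported to stage \<open>w\<close>.\<close>
    have disjoint: "Reidx P (\<rho> r w) \<epsilon> \<in> U w \<and>
        Reidx P (\<rho> r w) \<epsilon> \<sqinter>\<^bsub>fib w\<^esub> Reidx P (\<rho> s w) \<beta> = \<bottom>\<^bsub>fib w\<^esub>"
      if r: "r \<in> D" "s \<le> r" "r \<le> w" "\<epsilon> \<in> U r" and \<beta>: "\<beta> \<in> carrier (fib s)"
        and dis: "\<epsilon> \<sqinter>\<^bsub>fib r\<^esub> Reidx P (\<rho> s r) \<beta> = \<bottom>\<^bsub>fib r\<^esub>" for r \<epsilon> \<beta>
    proof -
      note rw = \<rho>_in[OF r(1) w(1) r(3)]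
      have "Reidx P (\<rho> r w) (\<epsilon> \<sqinter>\<^bsub>fib r\<^esub> Reidx P (\<rho> s r) \<beta>) =
          Reidx P (\<rho> r w) \<epsilon> \<sqinter>\<^bsub>fib w\<^esub> Reidx P (\<rho> s w) \<beta>"
        using Reidx_meet[OF rw lattice_filter_carrier[OF filter[OF r(1)] r(4)]
            Reidx_closed[OF \<rho>_in[OF s r(1,2)] \<beta>]] Reidx_\<rho>_trans[OF s r(1) w(1) r(2,3) \<beta>]
        by simp
      then show ?thesis
        using dis Reidx_bottom[OF rw] coherent_Reidx[OF U r(1) w(1) r(3,4)] by simp
    qed
    let ?a = "Reidx P (\<rho> s w) \<alpha>"
    have a: "?a \<in> carrier (fib w)" by (rule Reidx_closed[OF \<rho>_in[OF s w(1) sw] \<alpha>])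
    note wc = lattice_filter_carrier[OF filter[OF w(1)]]
    define \<gamma>' where "\<gamma>' = Reidx P (\<rho> u w) \<gamma>"
    define \<delta>' where "\<delta>' = Reidx P (\<rho> v w) \<delta>"
    have \<gamma>': "\<gamma>' \<in> U w" "\<gamma>' \<sqinter>\<^bsub>fib w\<^esub> ?a = \<bottom>\<^bsub>fib w\<^esub>"
      using disjoint[OF u(1,2) w(2) u(3) \<alpha> u(4)] by (auto simp: \<gamma>'_def)
    have \<delta>': "\<delta>' \<in> U w" "\<delta>' \<sqinter>\<^bsub>fib w\<^esub> compl (fib w) ?a = \<bottom>\<^bsub>fib w\<^esub>"
      using disjoint[OF v(1,2) w(3) v(3) s.compl_closed[OF \<alpha>] v(4)] Reidx_compl[OF \<rho>_in[OF s w(1) sw] \<alpha>]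
      by (auto simp: \<delta>'_def)
    have "compl (fib w) ?a \<in> U w"
      using lattice_filter_up[OF filter[OF w(1)] \<gamma>'(1)] w.le_of_disjoint_compl[OF a wc[OF \<gamma>'(1)] \<gamma>'(2)] a
      by simp
    then have "\<bottom>\<^bsub>fib w\<^esub> \<in> U w"
      using lattice_filter_meet[OF filter[OF w(1)] \<delta>'(1)] \<delta>'(2) by metis
    with coherent_proper[OF U w(1)] show False ..
  qed
  then have "ultrafilter (fib s) (U s)" if "s \<in> D" for s
    using that coherent_filter[OF U] coherent_proper[OF U] by (simp add: ultrafilter_def)
  with U GU show ?thesis by blast
qed

end


section \<open>Models from coherent ultrafilters\<close>

locale ultrafilter_diagram = doctrine_diagram C P D Z \<rho> + coded_diagram C D Z \<rho> code
  for C :: "('o, 'a) cat" and P :: "('o, 'a, 'p) doctrine" and D :: "'d::order set" and Z \<rho>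
    and code :: "'d \<Rightarrow> 'a \<Rightarrow> 'u" +
  fixes U :: "'d \<Rightarrow> 'p set"
  assumes U_coherent: "coherent U"
    and U_ultrafilter: "s \<in> D \<Longrightarrow> ultrafilter (fib s) (U s)"
begin

text \<open>Ultrafilters also reflect membership: if \<alpha> is not in \<open>U s\<close>, its
  complement is, and reindexes into \<open>U t\<close>.\<close>

lemma U_Reidx_iff:
  assumes s: "s \<in> D" "t \<in> D" "s \<le> t" and \<alpha>: "\<alpha> \<in> carrier (fib s)"
  shows "Reidx P (\<rho> s t) \<alpha> \<in> U t \<longleftrightarrow> \<alpha> \<in> U s"
proof -
  interpret s: boolean_alg "fib s" by (rule fib_boolean[OF s(1)])
  interpret t: boolean_alg "fib t" by (rule fib_boolean[OF s(2)])
  note st = \<rho>_in[OF s]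
  show ?thesis
    using coherent_Reidx[OF U_coherent s] s.ultrafilter_compl[OF U_ultrafilter[OF s(1)] \<alpha>]
      t.ultrafilter_compl[OF U_ultrafilter[OF s(2)] Reidx_closed[OF st \<alpha>]] Reidx_compl[OF st \<alpha>]
    by metis
qed

definition interp :: "'o \<Rightarrow> 'p \<Rightarrow> 'u set" where
  "interp X \<alpha> = {code s f | s f. s \<in> D \<and> f \<in> Hom C (Z s) X \<and> Reidx P f \<alpha> \<in> U s}"

lemma interp_sub: "interp X \<alpha> \<subseteq> colim X"
  by (auto simp: interp_def colim_def)

text \<open>Two representatives of one class agree at a later stage, and by
  \<open>U_Reidx_iff\<close> moving there does not change satisfaction. So any single representative
  decides.\<close>

lemma code_in_interp_iff:
  assumes s: "s \<in> D" "f \<in> Hom C (Z s) X" and \<alpha>: "\<alpha> \<in> carrier (Fib P X)"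
  shows "code s f \<in> interp X \<alpha> \<longleftrightarrow> Reidx P f \<alpha> \<in> U s"
proof
  assume "code s f \<in> interp X \<alpha>"
  then obtain t g where t: "t \<in> D" "g \<in> Hom C (Z t) X" and eq: "code s f = code t g"
    and in_U: "Reidx P g \<alpha> \<in> U t" by (auto simp: interp_def)
  obtain u where u: "u \<in> D" "s \<le> u" "t \<le> u" "Comp C f (\<rho> s u) = Comp C g (\<rho> t u)"
    using code_eqD[OF s t eq] by blast
  have "Reidx P f \<alpha> \<in> U s \<longleftrightarrow> Reidx P (Comp C f (\<rho> s u)) \<alpha> \<in> U u"
    using U_Reidx_iff[OF s(1) u(1,2) Reidx_closed[OF s(2) \<alpha>]]
      Reidx_Comp[OF \<rho>_in[OF s(1) u(1,2)] s(2) \<alpha>] by simp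
  also have "\<dots> \<longleftrightarrow> Reidx P g \<alpha> \<in> U t"
    using U_Reidx_iff[OF t(1) u(1,3) Reidx_closed[OF t(2) \<alpha>]]
      Reidx_Comp[OF \<rho>_in[OF t(1) u(1,3)] t(2) \<alpha>] u(4) by simp
  finally show "Reidx P f \<alpha> \<in> U s" using in_U by simp
qed (use s in \<open>auto simp: interp_def\<close>)

lemma interp_eqI:
  assumes "A \<subseteq> colim X" "B \<subseteq> colim X"
    and "\<And>s f. \<lbrakk>s \<in> D; f \<in> Hom C (Z s) X\<rbrakk> \<Longrightarrow> code s f \<in> A \<longleftrightarrow> code s f \<in> B"
  shows "A = B"
proof -
  have "x \<in> A \<longleftrightarrow> x \<in> B" if "x \<in> colim X" for x
    using that assms(3) by (elim colimE) simp
  then show ?thesis using assms(1,2) by blast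
qed

text \<open>On representatives, each Boolean operation commutes with reindexing and is then
  evaluated by the ultrafilter at that stage.\<close>

lemma interp_boolean_hom:
  assumes X: "X \<in> Obj C"
  shows "boolean_hom (Fib P X) (powerset_alg (colim X)) (interp X)"
proof -
  interpret X: boolean_alg "Fib P X" by (rule Fib_boolean[OF X])
  have sub: "interp X \<alpha> \<subseteq> colim X" for \<alpha> by (rule interp_sub)
  have "interp X \<top>\<^bsub>Fib P X\<^esub> = colim X"
    by (rule interp_eqI[OF sub order_refl])
      (auto simp: code_in_interp_iff Reidx_top colimI
        intro: boolean_alg.lattice_filter_top[OF fib_boolean] coherent_filter[OF U_coherent])
  moreover have "interp X \<bottom>\<^bsub>Fib P X\<^esub> = {}"
    by (rule interp_eqI[OF sub empty_subsetI])
      (auto simp: code_in_interp_iff Reidx_bottom coherent_proper[OF U_coherent])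
  moreover have "interp X (\<alpha> \<squnion>\<^bsub>Fib P X\<^esub> \<beta>) = interp X \<alpha> \<union> interp X \<beta>"
    "interp X (\<alpha> \<sqinter>\<^bsub>Fib P X\<^esub> \<beta>) = interp X \<alpha> \<inter> interp X \<beta>"
    if ab: "\<alpha> \<in> carrier (Fib P X)" "\<beta> \<in> carrier (Fib P X)" for \<alpha> \<beta>
  proof -
    show "interp X (\<alpha> \<squnion>\<^bsub>Fib P X\<^esub> \<beta>) = interp X \<alpha> \<union> interp X \<beta>"
      by (rule interp_eqI[OF sub Un_least[OF sub sub]])
        (simp add: code_in_interp_iff ab Reidx_join
          boolean_alg.ultrafilter_join[OF fib_boolean U_ultrafilter] Reidx_closed)
    show "interp X (\<alpha> \<sqinter>\<^bsub>Fib P X\<^esub> \<beta>) = interp X \<alpha> \<inter> interp X \<beta>"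
      by (rule interp_eqI[OF sub le_infI1[OF sub]])
        (simp add: code_in_interp_iff ab Reidx_meet
          boolean_alg.ultrafilter_meet[OF fib_boolean U_ultrafilter] Reidx_closed)
  qed
  moreover have "interp X (compl (Fib P X) \<alpha>) = colim X - interp X \<alpha>"
    if a: "\<alpha> \<in> carrier (Fib P X)" for \<alpha>
    by (rule interp_eqI[OF sub Diff_subset])
      (simp add: code_in_interp_iff a Reidx_compl colimI
        boolean_alg.ultrafilter_compl[OF fib_boolean U_ultrafilter] Reidx_closed)
  ultimately show ?thesis
    unfolding boolean_hom_def by (auto simp: powerset_alg_ops powerset_compl sub dest: subsetD[OF sub])
qed

text \<open>On a representative \<open>f\<close>, both sides ask whether \<alpha> reindexed along
  \<open>Comp C h f\<close> lies in the ultrafilter.\<close>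

lemma interp_natural:
  assumes h: "h \<in> Hom C X Y" and \<alpha>: "\<alpha> \<in> carrier (Fib P Y)"
  shows "interp X (Reidx P h \<alpha>) = colim_map h -` interp Y \<alpha> \<inter> colim X"
proof (rule interp_eqI[OF interp_sub Int_lower2])
  fix s f assume s: "s \<in> D" "f \<in> Hom C (Z s) X"
  show "code s f \<in> interp X (Reidx P h \<alpha>) \<longleftrightarrow> code s f \<in> colim_map h -` interp Y \<alpha> \<inter> colim X"
    using s code_in_interp_iff[OF s Reidx_closed[OF h \<alpha>]] colim_map_code[OF s h] colimI[OF s]
      code_in_interp_iff[OF s(1) Comp_in[OF s(2) h] \<alpha>] Reidx_Comp[OF s(2) h \<alpha>]
    by simp
qed

lemma interp_propositional_model:
  assumes "infinite (UNIV :: 'u set)"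
  shows "propositional_model C P colim_functor interp"
proof -
  interpret Set: boolean_doctrine "Set_cat :: ('u set, 'u set_arr) cat" subsets_doctrine
    by (rule subsets_boolean_doctrine[OF assms])
  interpret fp_functor C Set_cat colim_functor by (rule colim_fp_functor)
  show ?thesis
    unfolding propositional_model_def
  proof
    fix X assume "X \<in> Obj C"
    then show "boolean_hom (Fib P X) (Fib subsets_doctrine (FObj colim_functor X)) (interp X)"
      using interp_boolean_hom by (simp add: subsets_doctrine_def colim_functor_simps)
  next
    fix f X Y \<alpha> assume "f \<in> Hom C X Y" "\<alpha> \<in> carrier (Fib P Y)"
    then show "interp X (Reidx P f \<alpha>) = Reidx subsets_doctrine (FArr colim_functor f) (interp Y \<alpha>)"
      using interp_natural by (simp add: subsets_doctrine_def colim_functor_simps)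
  qed
qed

end


section \<open>Diagrams of finite products\<close>

text \<open>Factors are indexed by a set, so no order on them is chosen; for empty \<open>S\<close>
  the condition says that \<open>Z\<close> is terminal.\<close>

definition is_finprod :: "('o, 'a) cat \<Rightarrow> 'i set \<Rightarrow> ('i \<Rightarrow> 'o) \<Rightarrow> 'o \<Rightarrow> ('i \<Rightarrow> 'a) \<Rightarrow> bool" where
  "is_finprod C S X Z \<pi> \<longleftrightarrow>
     Z \<in> Obj C \<and> (\<forall>i\<in>S. \<pi> i \<in> Hom C Z (X i)) \<and>
     (\<forall>W\<in>Obj C. \<forall>f. (\<forall>i\<in>S. f i \<in> Hom C W (X i)) \<longrightarrow>
        (\<exists>!h. h \<in> Hom C W Z \<and> (\<forall>i\<in>S. Comp C (\<pi> i) h = f i)))"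

text \<open>Induction on \<open>S\<close>: start from a terminal object, then take the binary
  product of the new factor with the product obtained so far.\<close>

lemma (in fp_category) ex_finprod:
  assumes "finite S" "\<And>i. i \<in> S \<Longrightarrow> X i \<in> Obj C"
  shows "\<exists>Z \<pi>. is_finprod C S X Z \<pi>"
  using assms
proof (induction S rule: finite_induct)
  case empty
  obtain T where "is_terminal C T" using ex_terminal ..
  then show ?case by (auto simp: is_finprod_def is_terminal_def)
next
  case (insert i S)
  then obtain Z \<pi> where Z: "is_finprod C S X Z \<pi>" by auto
  then have Z_Obj: "Z \<in> Obj C" and \<pi>: "\<And>j. j \<in> S \<Longrightarrow> \<pi> j \<in> Hom C Z (X j)"
    by (auto simp: is_finprod_def)
  obtain V p q where V: "is_product C (X i) Z V p q"
    using ex_product[of "X i" Z] insert.prems Z_Obj by blast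
  then have p: "V \<in> Obj C" "p \<in> Hom C V (X i)" "q \<in> Hom C V Z" by (auto simp: is_product_def)
  define \<pi>' where "\<pi>' j = (if j = i then p else Comp C (\<pi> j) q)" for j
  have \<pi>'_S: "\<pi>' j = Comp C (\<pi> j) q" if "j \<in> S" for j
    using that insert.hyps by (auto simp: \<pi>'_def)
  have \<pi>'_Comp: "Comp C (\<pi>' j) h = Comp C (\<pi> j) (Comp C q h)"
    if "j \<in> S" "h \<in> Hom C W V" for j h W
    using Comp_assoc[OF that(2) p(3) \<pi>[OF that(1)]] by (simp add: \<pi>'_S that)
  have "is_finprod C (insert i S) X V \<pi>'"
    unfolding is_finprod_def
  proof (intro conjI ballI allI impI)
    show "V \<in> Obj C" by fact
    fix j assume "j \<in> insert i S"
    then show "\<pi>' j \<in> Hom C V (X j)"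
      using p \<pi> Comp_in by (auto simp: \<pi>'_def)
  next
    fix W f assume W: "W \<in> Obj C" and f: "\<forall>j\<in>insert i S. f j \<in> Hom C W (X j)"
    then obtain g where g: "g \<in> Hom C W Z" "\<forall>j\<in>S. Comp C (\<pi> j) g = f j"
      and g_unique: "\<And>g'. g' \<in> Hom C W Z \<Longrightarrow> \<forall>j\<in>S. Comp C (\<pi> j) g' = f j \<Longrightarrow> g' = g"
      using Z unfolding is_finprod_def by (metis insertCI)
    have "f i \<in> Hom C W (X i)" using f by simp
    then obtain h where h: "h \<in> Hom C W V" "Comp C p h = f i" "Comp C q h = g"
      and h_unique: "\<And>h'. h' \<in> Hom C W V \<Longrightarrow> Comp C p h' = f i \<Longrightarrow> Comp C q h' = g \<Longrightarrow> h' = h"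
      using V W g(1) unfolding is_product_def by metis
    show "\<exists>!h. h \<in> Hom C W V \<and> (\<forall>j\<in>insert i S. Comp C (\<pi>' j) h = f j)"
    proof (rule ex1I[of _ h])
      show "h \<in> Hom C W V \<and> (\<forall>j\<in>insert i S. Comp C (\<pi>' j) h = f j)"
        using h g \<pi>'_Comp[OF _ h(1)] by (auto simp: \<pi>'_def)
    next
      fix h' assume h': "h' \<in> Hom C W V \<and> (\<forall>j\<in>insert i S. Comp C (\<pi>' j) h' = f j)"
      then have "Comp C p h' = f i" by (simp add: \<pi>'_def)
      moreover have "Comp C q h' = g"
        using h' \<pi>'_Comp[of _ h' W] by (intro g_unique) (auto intro: Comp_in p)
      ultimately show "h' = h" using h' h_unique by blast
    qed
  qed
  then show ?case by blast
qed

locale finprod_diagram = fp_category C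
  for C :: "('o, 'a) cat" +
  fixes I :: "'i set" and X :: "'i \<Rightarrow> 'o" and Z :: "'i set \<Rightarrow> 'o" and \<pi> :: "'i set \<Rightarrow> 'i \<Rightarrow> 'a"
  assumes X_Obj: "i \<in> I \<Longrightarrow> X i \<in> Obj C"
    and finprod: "S \<in> Fpow I \<Longrightarrow> is_finprod C S X (Z S) (\<pi> S)"
begin

lemma finprod_Obj: "S \<in> Fpow I \<Longrightarrow> Z S \<in> Obj C"
  and \<pi>_in: "\<lbrakk>S \<in> Fpow I; i \<in> S\<rbrakk> \<Longrightarrow> \<pi> S i \<in> Hom C (Z S) (X i)"
  using finprod unfolding is_finprod_def by auto

lemma finprod_ex1:
  assumes "S \<in> Fpow I" "W \<in> Obj C" "\<And>i. i \<in> S \<Longrightarrow> f i \<in> Hom C W (X i)"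
  shows "\<exists>!h. h \<in> Hom C W (Z S) \<and> (\<forall>i\<in>S. Comp C (\<pi> S i) h = f i)"
  using finprod[OF assms(1)] assms(2,3) unfolding is_finprod_def by simp

lemma finprod_arr_eqI:
  assumes S: "S \<in> Fpow I" and h: "h \<in> Hom C W (Z S)" "h' \<in> Hom C W (Z S)"
    and eq: "\<And>i. i \<in> S \<Longrightarrow> Comp C (\<pi> S i) h = Comp C (\<pi> S i) h'"
  shows "h = h'"
proof -
  have W: "W \<in> Obj C" using h(1) Dom_in by (auto simp: Hom_def)
  have "\<exists>!k. k \<in> Hom C W (Z S) \<and> (\<forall>i\<in>S. Comp C (\<pi> S i) k = Comp C (\<pi> S i) h')"
    by (rule finprod_ex1[OF S W Comp_in[OF h(2) \<pi>_in[OF S]]])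
  with h eq show ?thesis by (metis (no_types, lifting))
qed

text \<open>For \<open>S \<subseteq> T\<close>, the canonical projection discarding the factors in
  \<open>T - S\<close>.\<close>

definition proj :: "'i set \<Rightarrow> 'i set \<Rightarrow> 'a" where
  "proj S T = (THE h. h \<in> Hom C (Z T) (Z S) \<and> (\<forall>i\<in>S. Comp C (\<pi> S i) h = \<pi> T i))"

lemma
  assumes S: "S \<in> Fpow I" and T: "T \<in> Fpow I" and "S \<subseteq> T"
  shows proj_in: "proj S T \<in> Hom C (Z T) (Z S)"
    and \<pi>_proj: "i \<in> S \<Longrightarrow> Comp C (\<pi> S i) (proj S T) = \<pi> T i"
proof -
  have "\<exists>!h. h \<in> Hom C (Z T) (Z S) \<and> (\<forall>i\<in>S. Comp C (\<pi> S i) h = \<pi> T i)"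
    by (rule finprod_ex1[OF S finprod_Obj[OF T] \<pi>_in[OF T]]) (use \<open>S \<subseteq> T\<close> in blast)
  from theI'[OF this] show "proj S T \<in> Hom C (Z T) (Z S)"
    "i \<in> S \<Longrightarrow> Comp C (\<pi> S i) (proj S T) = \<pi> T i"
    unfolding proj_def by auto
qed

text \<open>Finite subsets are directed under union; the functor laws hold because the projections
  \<open>\<pi> S i\<close> are jointly monic.\<close>

sublocale directed_diagram C "Fpow I" Z proj
proof
  show "Fpow I \<noteq> {}" by (rule Fpow_not_empty)
  fix S assume S: "S \<in> Fpow I"
  show "Z S \<in> Obj C" by (rule finprod_Obj[OF S])
  show "proj S S = Id C (Z S)"
    by (rule finprod_arr_eqI[OF S proj_in[OF S S order_refl] Id_in[OF finprod_Obj[OF S]]])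
      (use S \<pi>_proj[OF S S order_refl] Comp_Id_right[OF \<pi>_in[OF S]] in simp)
  fix T assume T: "T \<in> Fpow I"
  show "\<exists>U\<in>Fpow I. S \<le> U \<and> T \<le> U"
    using S T by (intro bexI[of _ "S \<union> T"]) (auto simp: Fpow_def)
  show "proj S T \<in> Hom C (Z T) (Z S)" if "S \<le> T"
    by (rule proj_in[OF S T that])
  fix U assume U: "U \<in> Fpow I" and ST: "S \<le> T" and TU: "T \<le> U"
  have SU: "S \<subseteq> U" using ST TU by simp
  note arr = proj_in[OF S T ST] proj_in[OF T U TU]
  show "Comp C (proj S T) (proj T U) = proj S U"
  proof (rule finprod_arr_eqI[OF S Comp_in[OF arr(2,1)] proj_in[OF S U SU]])
    fix i assume i: "i \<in> S"
    show "Comp C (\<pi> S i) (Comp C (proj S T) (proj T U)) = Comp C (\<pi> S i) (proj S U)"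
      using Comp_assoc[OF arr(2,1) \<pi>_in[OF S i]] \<pi>_proj[OF S T ST i] \<pi>_proj[OF S U SU i]
        \<pi>_proj[OF T U TU, of i] i ST by auto
  qed
qed

lemma finprod_empty_terminal: "is_terminal C (Z {})"
proof -
  have "is_finprod C {} X (Z {}) (\<pi> {})" by (rule finprod[OF empty_in_Fpow])
  then show ?thesis by (auto simp: is_finprod_def is_terminal_def)
qed

text \<open>The products for different finite sets are chosen independently. Recognising one as a
  binary product makes the primeness condition on \<open>F\<close> applicable to it.\<close>

lemma finprod_insert_product:
  assumes S: "insert i S \<in> Fpow I" and i: "i \<notin> S"
  shows "is_product C (X i) (Z S) (Z (insert i S)) (\<pi> (insert i S) i) (proj S (insert i S))"
proof -
  let ?T = "insert i S"
  have S': "S \<in> Fpow I" and i_I: "i \<in> I" using S by (auto simp: Fpow_def)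
  note arr = \<pi>_in[OF S insertI1] proj_in[OF S' S subset_insertI]
  have comp: "Comp C (\<pi> ?T j) h = Comp C (\<pi> S j) (Comp C (proj S ?T) h)"
    if "j \<in> S" "h \<in> Hom C W (Z ?T)" for j h W
    using Comp_assoc[OF that(2) arr(2) \<pi>_in[OF S' that(1)]] \<pi>_proj[OF S' S subset_insertI that(1)]
    by simp
  show ?thesis
    unfolding is_product_def
  proof (intro conjI ballI)
    fix W f g assume W: "W \<in> Obj C" and f: "f \<in> Hom C W (X i)" and g: "g \<in> Hom C W (Z S)"
    \<comment> \<open>The family of components for the pair: \<open>f\<close> at the new index, the
      components of \<open>g\<close> elsewhere.\<close>
    define k where "k j = (if j = i then f else Comp C (\<pi> S j) g)" for j
    have k: "k i = f" "\<And>j. j \<in> S \<Longrightarrow> k j = Comp C (\<pi> S j) g" using i by (auto simp: k_def)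
    have "k j \<in> Hom C W (X j)" if "j \<in> ?T" for j
      using that f \<pi>_in[OF S'] Comp_in[OF g] k by auto
    then obtain h where h: "h \<in> Hom C W (Z ?T)" "\<forall>j\<in>?T. Comp C (\<pi> ?T j) h = k j"
      using finprod_ex1[OF S W, of k] by blast
    show "\<exists>!h. h \<in> Hom C W (Z ?T) \<and> Comp C (\<pi> ?T i) h = f \<and> Comp C (proj S ?T) h = g"
    proof (rule ex1I[of _ h])
      have "Comp C (proj S ?T) h = g"
        by (rule finprod_arr_eqI[OF S' Comp_in[OF h(1) arr(2)] g]) (use h k comp in force)
      then show "h \<in> Hom C W (Z ?T) \<and> Comp C (\<pi> ?T i) h = f \<and> Comp C (proj S ?T) h = g"
        using h k by simp
    next
      fix h' assume h': "h' \<in> Hom C W (Z ?T) \<and> Comp C (\<pi> ?T i) h' = f \<and> Comp C (proj S ?T) h' = g"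
      show "h' = h"
      proof (rule finprod_arr_eqI[OF S _ h(1)])
        fix j assume "j \<in> ?T"
        then show "Comp C (\<pi> ?T j) h' = Comp C (\<pi> ?T j) h"
          using h h' k comp[of j h' W] by auto
      qed (use h' in simp)
    qed
  qed (use arr S S' i_I X_Obj finprod_Obj in auto)
qed

end


section \<open>Separating a universal ultrafilter from the formulas outside it\<close>

locale refutation_diagram = boolean_doctrine C P + finprod_diagram C I X Z \<pi>
  for C :: "('o, 'a) cat" and P :: "('o, 'a, 'p) doctrine"
    and I :: "'i set" and X Z \<pi> +
  fixes F :: "'o \<Rightarrow> 'p set" and \<alpha> :: "'i \<Rightarrow> 'p"
  assumes F: "universal_ultrafilter C P F"
    and \<alpha>_in: "i \<in> I \<Longrightarrow> \<alpha> i \<in> carrier (Fib P (X i))"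
    and \<alpha>_notin: "i \<in> I \<Longrightarrow> \<alpha> i \<notin> F (X i)"
begin

sublocale doctrine_diagram C P "Fpow I" Z proj ..

lemma F_filter: "Y \<in> Obj C \<Longrightarrow> lattice_filter (Fib P Y) (F Y)"
  and F_Reidx: "\<lbrakk>f \<in> Hom C Y W; \<beta> \<in> F W\<rbrakk> \<Longrightarrow> Reidx P f \<beta> \<in> F Y"
  using F Hom_Obj[of f Y W] unfolding universal_ultrafilter_def by auto

lemma F_prime:
  "\<lbrakk>is_product C X\<^sub>1 X\<^sub>2 W p\<^sub>1 p\<^sub>2; \<alpha>\<^sub>1 \<in> carrier (Fib P X\<^sub>1); \<alpha>\<^sub>2 \<in> carrier (Fib P X\<^sub>2);
    Reidx P p\<^sub>1 \<alpha>\<^sub>1 \<squnion>\<^bsub>Fib P W\<^esub> Reidx P p\<^sub>2 \<alpha>\<^sub>2 \<in> F W\<rbrakk> \<Longrightarrow> \<alpha>\<^sub>1 \<in> F X\<^sub>1 \<or> \<alpha>\<^sub>2 \<in> F X\<^sub>2"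
  using F unfolding universal_ultrafilter_def by blast

section \<open>Disjunctions of the formulas to be refuted, each at its own constant\<close>

definition instance_at :: "'i set \<Rightarrow> 'i \<Rightarrow> 'p" where
  "instance_at S i = Reidx P (\<pi> S i) (\<alpha> i)"

lemma instance_closed: "\<lbrakk>S \<in> Fpow I; i \<in> S\<rbrakk> \<Longrightarrow> instance_at S i \<in> carrier (fib S)"
  unfolding instance_at_def by (rule Reidx_closed[OF \<pi>_in \<alpha>_in]) (auto simp: Fpow_def)

lemma Reidx_instance:
  assumes "S \<in> Fpow I" "T \<in> Fpow I" "S \<subseteq> T" "i \<in> S"
  shows "Reidx P (proj S T) (instance_at S i) = instance_at T i"
  using Reidx_Comp[OF proj_in[OF assms(1-3)] \<pi>_in[OF assms(1,4)] \<alpha>_in] \<pi>_proj[OF assms] assms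
  by (auto simp: instance_at_def Fpow_def)

text \<open>Allowing any order and repetitions avoids enumerating \<open>S\<close>; the empty
  disjunction is bottom.\<close>

inductive_set joins :: "'i set \<Rightarrow> 'p set" for S where
  joins_bottom: "\<bottom>\<^bsub>fib S\<^esub> \<in> joins S"
| joins_step: "\<lbrakk>i \<in> S; b \<in> joins S\<rbrakk> \<Longrightarrow> instance_at S i \<squnion>\<^bsub>fib S\<^esub> b \<in> joins S"

lemma joins_closed:
  assumes S: "S \<in> Fpow I" and b: "b \<in> joins S"
  shows "b \<in> carrier (fib S)"
proof -
  interpret S: boolean_alg "fib S" by (rule fib_boolean[OF S])
  show ?thesis using b by induction (auto simp: instance_closed[OF S])
qed

text \<open>The disjuncts of \<open>b\<close> are added one by one to \<open>b'\<close>.\<close>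

lemma joins_directed:
  assumes S: "S \<in> Fpow I" and b: "b \<in> joins S" and b': "b' \<in> joins S"
  shows "\<exists>c\<in>joins S. b \<sqsubseteq>\<^bsub>fib S\<^esub> c \<and> b' \<sqsubseteq>\<^bsub>fib S\<^esub> c"
proof -
  interpret S: boolean_alg "fib S" by (rule fib_boolean[OF S])
  show ?thesis
    using b
  proof induction
    case joins_bottom
    then show ?case using b' joins_closed[OF S b'] by blast
  next
    case (joins_step i b)
    then obtain c where c: "c \<in> joins S" "b \<sqsubseteq>\<^bsub>fib S\<^esub> c" "b' \<sqsubseteq>\<^bsub>fib S\<^esub> c" by blast
    note carr = instance_closed[OF S joins_step.hyps(1)] joins_closed[OF S joins_step.hyps(2)]
      joins_closed[OF S c(1)] joins_closed[OF S b']
    show ?case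
    proof (intro bexI conjI)
      show "instance_at S i \<squnion>\<^bsub>fib S\<^esub> c \<in> joins S"
        using joins_step.hyps(1) c(1) by (rule joins.joins_step)
      show "instance_at S i \<squnion>\<^bsub>fib S\<^esub> b \<sqsubseteq>\<^bsub>fib S\<^esub> instance_at S i \<squnion>\<^bsub>fib S\<^esub> c"
        using c carr by (intro S.join_mono) auto
      show "b' \<sqsubseteq>\<^bsub>fib S\<^esub> instance_at S i \<squnion>\<^bsub>fib S\<^esub> c"
        using c carr by (intro S.le_trans[OF c(3) S.join_right]) auto
    qed
  qed
qed

lemma Reidx_joins:
  assumes S: "S \<in> Fpow I" "T \<in> Fpow I" "S \<subseteq> T" and b: "b \<in> joins S"
  shows "Reidx P (proj S T) b \<in> joins T"
  using b
proof induction
  case joins_bottom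
  then show ?case using Reidx_bottom[OF proj_in[OF S]] by (simp add: joins.joins_bottom)
next
  case (joins_step i b)
  then show ?case
    using Reidx_join[OF proj_in[OF S] instance_closed[OF S(1)] joins_closed[OF S(1)]] S(3)
    by (auto simp: Reidx_instance[OF S] intro: joins.joins_step)
qed

text \<open>Disjuncts at \<open>i\<close> are absorbed into one, and the others come from
  \<open>S\<close>. An inequality suffices, as it will be applied to an upward closed set.\<close>

lemma joins_insert_le:
  assumes T: "insert i S \<in> Fpow I" and b: "b \<in> joins (insert i S)"
  shows "\<exists>c\<in>joins S. b \<sqsubseteq>\<^bsub>fib (insert i S)\<^esub>
    instance_at (insert i S) i \<squnion>\<^bsub>fib (insert i S)\<^esub> Reidx P (proj S (insert i S)) c"
proof -
  let ?T = "insert i S"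
  have S: "S \<in> Fpow I" using T by (auto simp: Fpow_def)
  interpret S: boolean_alg "fib S" by (rule fib_boolean[OF S])
  interpret T: boolean_alg "fib ?T" by (rule fib_boolean[OF T])
  note pr = proj_in[OF S T subset_insertI]
  let ?a = "instance_at ?T i"
  have a: "?a \<in> carrier (fib ?T)" using instance_closed[OF T] by simp
  show ?thesis
    using b
  proof induction
    case joins_bottom
    show ?case
      using a Reidx_closed[OF pr S.bottom_closed] by (intro bexI[OF _ joins.joins_bottom]) simp
  next
    case (joins_step j b)
    then obtain c where c: "c \<in> joins S" "b \<sqsubseteq>\<^bsub>fib ?T\<^esub> ?a \<squnion>\<^bsub>fib ?T\<^esub> Reidx P (proj S ?T) c" by blast
    note cS = joins_closed[OF S c(1)]
    note carr = a instance_closed[OF T joins_step.hyps(1)] joins_closed[OF T joins_step.hyps(2)]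
      Reidx_closed[OF pr cS]
    show ?case
    proof (cases "j = i")
      case True
      then have "instance_at ?T j \<squnion>\<^bsub>fib ?T\<^esub> b \<sqsubseteq>\<^bsub>fib ?T\<^esub> ?a \<squnion>\<^bsub>fib ?T\<^esub> Reidx P (proj S ?T) c"
        using carr c(2) by (intro T.join_le) (auto intro: T.join_left)
      then show ?thesis using c(1) by blast
    next
      case False
      then have j: "j \<in> S" using joins_step.hyps(1) by simp
      let ?c = "instance_at S j \<squnion>\<^bsub>fib S\<^esub> c"
      have eq: "Reidx P (proj S ?T) ?c = instance_at ?T j \<squnion>\<^bsub>fib ?T\<^esub> Reidx P (proj S ?T) c"
        using Reidx_join[OF pr instance_closed[OF S j] cS] Reidx_instance[OF S T subset_insertI j] by simp
      have "b \<sqsubseteq>\<^bsub>fib ?T\<^esub> ?a \<squnion>\<^bsub>fib ?T\<^esub> Reidx P (proj S ?T) ?c"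
        unfolding eq using carr
        by (intro T.le_trans[OF c(2) T.join_mono[OF T.le_refl T.join_right]]) auto
      moreover have "instance_at ?T j \<sqsubseteq>\<^bsub>fib ?T\<^esub> ?a \<squnion>\<^bsub>fib ?T\<^esub> Reidx P (proj S ?T) ?c"
        unfolding eq using carr
        by (intro T.le_trans[OF T.join_left T.join_right]) auto
      ultimately have "instance_at ?T j \<squnion>\<^bsub>fib ?T\<^esub> b \<sqsubseteq>\<^bsub>fib ?T\<^esub> ?a \<squnion>\<^bsub>fib ?T\<^esub> Reidx P (proj S ?T) ?c"
        using carr by (intro T.join_le) (auto simp: eq)
      then show ?thesis using joins.joins_step[OF j c(1)] by blast
    qed
  qed
qed

text \<open>Induction on the set of constants: the empty disjunction is excluded at a terminal
  object, and primeness splits off one constant at a time.\<close>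

lemma joins_notin_F:
  assumes "S \<in> Fpow I" "b \<in> joins S"
  shows "b \<notin> F (Z S)"
proof -
  have "finite S" using assms(1) by (simp add: Fpow_def)
  then show ?thesis
    using assms
  proof (induction S arbitrary: b rule: finite_induct)
    case empty
    have "b = \<bottom>\<^bsub>fib {}\<^esub>" using empty.prems(2) by cases auto
    then show ?case using F finprod_empty_terminal unfolding universal_ultrafilter_def by blast
  next
    case (insert i S)
    let ?T = "insert i S"
    have T: "?T \<in> Fpow I" and S: "S \<in> Fpow I" and i: "i \<in> I"
      using insert.prems(1) by (auto simp: Fpow_def)
    interpret T: boolean_alg "fib ?T" by (rule fib_boolean[OF T])
    obtain c where c: "c \<in> joins S"
      "b \<sqsubseteq>\<^bsub>fib ?T\<^esub> instance_at ?T i \<squnion>\<^bsub>fib ?T\<^esub> Reidx P (proj S ?T) c"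
      using joins_insert_le[OF T insert.prems(2)] by blast
    note cS = joins_closed[OF S c(1)]
    show ?case
    proof
      assume "b \<in> F (Z ?T)"
      then have "instance_at ?T i \<squnion>\<^bsub>fib ?T\<^esub> Reidx P (proj S ?T) c \<in> F (Z ?T)"
        using lattice_filter_up[OF F_filter[OF Z_Obj[OF T]] _ c(2)] instance_closed[OF T]
          Reidx_closed[OF proj_in[OF S T subset_insertI] cS] by simp
      then have "\<alpha> i \<in> F (X i) \<or> c \<in> F (Z S)"
        using F_prime[OF finprod_insert_product[OF T insert.hyps(2)] \<alpha>_in[OF i] cS]
        by (simp add: instance_at_def)
      then show False using \<alpha>_notin[OF i] insert.IH[OF S c(1)] by blast
    qed
  qed
qed

text \<open>The condition says that the implication from the negation of \<open>b\<close> to \<beta>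
  lies in \<open>F\<close>; hence these are the consequences of \<open>F\<close> and the negated
  instances.\<close>

definition refuting :: "'i set \<Rightarrow> 'p set" where
  "refuting S = {\<beta> \<in> carrier (fib S). \<exists>b\<in>joins S. \<beta> \<squnion>\<^bsub>fib S\<^esub> b \<in> F (Z S)}"

lemma F_sub_refuting:
  assumes S: "S \<in> Fpow I"
  shows "F (Z S) \<subseteq> refuting S"
proof
  interpret S: boolean_alg "fib S" by (rule fib_boolean[OF S])
  fix \<beta> assume \<beta>: "\<beta> \<in> F (Z S)"
  then have "\<beta> \<in> carrier (fib S)" using lattice_filter_carrier[OF F_filter[OF Z_Obj[OF S]]] by blast
  then show "\<beta> \<in> refuting S"
    using \<beta> by (auto simp: refuting_def intro!: bexI[OF _ joins_bottom])
qed

text \<open>Properness reduces to \<open>joins_notin_F\<close>. For meets, the two disjunctions are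
  first replaced by a common larger one, after which distributivity applies.\<close>

lemma refuting_coherent: "coherent refuting"
  unfolding coherent_def
proof (intro conjI ballI impI)
  fix S assume S: "S \<in> Fpow I"
  interpret S: boolean_alg "fib S" by (rule fib_boolean[OF S])
  note filter = F_filter[OF Z_Obj[OF S]]
  show "lattice_filter (fib S) (refuting S)"
    unfolding lattice_filter_def
  proof (intro conjI ballI impI)
    show "refuting S \<subseteq> carrier (fib S)" by (auto simp: refuting_def)
    show "refuting S \<noteq> {}" using F_sub_refuting[OF S] S.lattice_filter_top[OF filter] by blast
  next
    fix \<beta> \<beta>' assume "\<beta> \<in> refuting S" "\<beta>' \<in> refuting S"
    then obtain b b' where \<beta>: "\<beta> \<in> carrier (fib S)" "\<beta>' \<in> carrier (fib S)"
      and b: "b \<in> joins S" "\<beta> \<squnion>\<^bsub>fib S\<^esub> b \<in> F (Z S)" and b': "b' \<in> joins S" "\<beta>' \<squnion>\<^bsub>fib S\<^esub> b' \<in> F (Z S)"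
      by (auto simp: refuting_def)
    obtain c where c: "c \<in> joins S" "b \<sqsubseteq>\<^bsub>fib S\<^esub> c" "b' \<sqsubseteq>\<^bsub>fib S\<^esub> c"
      using joins_directed[OF S b(1) b'(1)] by blast
    note carr = \<beta> joins_closed[OF S c(1)] joins_closed[OF S b(1)] joins_closed[OF S b'(1)]
    have "\<beta> \<squnion>\<^bsub>fib S\<^esub> c \<in> F (Z S)"
      using carr c by (intro lattice_filter_up[OF filter b(2)] S.join_mono) auto
    moreover have "\<beta>' \<squnion>\<^bsub>fib S\<^esub> c \<in> F (Z S)"
      using carr c by (intro lattice_filter_up[OF filter b'(2)] S.join_mono) auto
    ultimately have "(\<beta> \<squnion>\<^bsub>fib S\<^esub> c) \<sqinter>\<^bsub>fib S\<^esub> (\<beta>' \<squnion>\<^bsub>fib S\<^esub> c) \<in> F (Z S)"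
      by (rule lattice_filter_meet[OF filter])
    then have "(\<beta> \<sqinter>\<^bsub>fib S\<^esub> \<beta>') \<squnion>\<^bsub>fib S\<^esub> c \<in> F (Z S)"
      using carr by (intro lattice_filter_up[OF filter _ S.join_meet_distrib_le]) auto
    then show "\<beta> \<sqinter>\<^bsub>fib S\<^esub> \<beta>' \<in> refuting S"
      using carr c(1) by (auto simp: refuting_def)
  next
    fix \<beta> \<beta>' assume "\<beta> \<in> refuting S" and \<beta>': "\<beta>' \<in> carrier (fib S)" "\<beta> \<sqsubseteq>\<^bsub>fib S\<^esub> \<beta>'"
    then obtain b where \<beta>: "\<beta> \<in> carrier (fib S)" and b: "b \<in> joins S" "\<beta> \<squnion>\<^bsub>fib S\<^esub> b \<in> F (Z S)"
      by (auto simp: refuting_def)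
    have "\<beta>' \<squnion>\<^bsub>fib S\<^esub> b \<in> F (Z S)"
      using \<beta> \<beta>' joins_closed[OF S b(1)]
      by (intro lattice_filter_up[OF filter b(2)] S.join_mono) auto
    then show "\<beta>' \<in> refuting S" using \<beta>' b(1) by (auto simp: refuting_def)
  qed
  show "\<bottom>\<^bsub>fib S\<^esub> \<notin> refuting S"
  proof
    assume "\<bottom>\<^bsub>fib S\<^esub> \<in> refuting S"
    then obtain b where b: "b \<in> joins S" "\<bottom>\<^bsub>fib S\<^esub> \<squnion>\<^bsub>fib S\<^esub> b \<in> F (Z S)" by (auto simp: refuting_def)
    then have "b \<in> F (Z S)"
      using joins_closed[OF S b(1)] join_comm[of "fib S" "\<bottom>\<^bsub>fib S\<^esub>" b] by simp
    with joins_notin_F[OF S b(1)] show False ..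
  qed
next
  fix S T \<beta> assume S: "S \<in> Fpow I" "T \<in> Fpow I" "S \<le> T" and "\<beta> \<in> refuting S"
  then obtain b where \<beta>: "\<beta> \<in> carrier (fib S)" and b: "b \<in> joins S" "\<beta> \<squnion>\<^bsub>fib S\<^esub> b \<in> F (Z S)"
    by (auto simp: refuting_def)
  note pr = proj_in[OF S]
  have "Reidx P (proj S T) \<beta> \<squnion>\<^bsub>fib T\<^esub> Reidx P (proj S T) b \<in> F (Z T)"
    using F_Reidx[OF pr b(2)] Reidx_join[OF pr \<beta> joins_closed[OF S(1) b(1)]] by simp
  then show "Reidx P (proj S T) \<beta> \<in> refuting T"
    using Reidx_joins[OF S b(1)] Reidx_closed[OF pr \<beta>] by (auto simp: refuting_def)
qed

text \<open>The instance itself serves as the disjunction, by excluded middle.\<close>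

lemma compl_instance_refuting:
  assumes S: "S \<in> Fpow I" and i: "i \<in> S"
  shows "compl (fib S) (instance_at S i) \<in> refuting S"
proof -
  interpret S: boolean_alg "fib S" by (rule fib_boolean[OF S])
  note a = instance_closed[OF S i]
  have "instance_at S i \<in> joins S" using joins_step[OF i joins_bottom] a by simp
  moreover have "compl (fib S) (instance_at S i) \<squnion>\<^bsub>fib S\<^esub> instance_at S i = \<top>\<^bsub>fib S\<^esub>"
    using S.join_compl[OF a] join_comm[of "fib S"] by metis
  ultimately show ?thesis
    using a S.lattice_filter_top[OF F_filter[OF Z_Obj[OF S]]]
    by (auto simp: refuting_def intro!: bexI[of _ "instance_at S i"])
qed

end

text \<open>Besides assembling the construction, this checks that representatives of the colimit
  elements are few enough to be named in the universe.\<close>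

lemma (in boolean_doctrine) universal_ultrafilter_model:
  assumes universe: "infinite (UNIV :: 'u set)"
    and small_category: "Arr C \<lesssim> (UNIV :: 'u set)"
    and small_fibres: "\<And>X. X \<in> Obj C \<Longrightarrow> carrier (Fib P X) \<lesssim> (UNIV :: 'u set)"
    and F: "universal_ultrafilter C P F"
  shows "\<exists>(M :: ('o, 'a, 'u set, 'u set_arr) func) \<mm>. propositional_model C P M \<mm> \<and>
    (\<forall>X\<in>Obj C. F X = {\<alpha> \<in> carrier (Fib P X). \<forall>x\<in>FObj M X. x \<in> \<mm> X \<alpha>})"
proof -
  \<comment> \<open>An index is its own pair of sort and formula, so \<open>fst\<close> and
    \<open>snd\<close> supply the sorts and the formulas to refute.\<close>
  define I where "I = (SIGMA X:Obj C. carrier (Fib P X) - F X)"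
  have "\<exists>Z \<pi>. is_finprod C S fst Z \<pi>" if "S \<in> Fpow I" for S
    using that by (intro ex_finprod) (auto simp: Fpow_def I_def)
  then obtain Z \<pi> where fp: "\<And>S. S \<in> Fpow I \<Longrightarrow> is_finprod C S fst (Z S) (\<pi> S)" by metis
  interpret refutation_diagram C P I fst Z \<pi> F snd
    by unfold_locales (use F fp in \<open>auto simp: I_def\<close>)

  have square: "(UNIV :: 'u set) \<times> (UNIV :: 'u set) \<lesssim> (UNIV :: 'u set)"
    using infinite_pairing[OF universe] by (metis UNIV_Times_UNIV lepoll_def subset_UNIV)
  \<comment> \<open>Identities embed the objects into the arrows, so smallness of
    \<open>Arr C\<close> bounds \<open>Obj C\<close> too.\<close>
  have "inj_on (Id C) (Obj C)"
    using Id_in by (intro inj_onI) (auto simp: Hom_def, metis)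
  then have "Obj C \<lesssim> Arr C"
    using Id_in by (auto simp: lepoll_def Hom_def)
  then have Obj_small: "Obj C \<lesssim> (UNIV :: 'u set)" using small_category by (rule lepoll_trans)
  have "I \<lesssim> Obj C \<times> (UNIV :: 'u set)"
    unfolding I_def
    by (rule Sigma_lepoll_mono) (auto intro: lepoll_trans[OF subset_imp_lepoll small_fibres])
  also have "\<dots> \<lesssim> (UNIV :: 'u set) \<times> (UNIV :: 'u set)"
    using Obj_small by (intro times_lepoll_mono) auto
  finally have "I \<lesssim> (UNIV :: 'u set)" using square lepoll_trans by blast
  then obtain e :: "'o \<times> 'p \<Rightarrow> 'u" where "inj_on e I" by (auto simp: lepoll_def)
  \<comment> \<open>An infinite universe has no more finite subsets than elements, so the stages of
    the diagram are small as well.\<close>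
  then have "Fpow I \<lesssim> Fpow (UNIV :: 'u set)"
    using inj_on_image_Fpow[of e I] image_Fpow_mono[of e I UNIV] by (auto simp: lepoll_def)
  also have "\<dots> \<approx> (UNIV :: 'u set)" by (rule eqpoll_Fpow[OF universe])
  finally have "Fpow I \<lesssim> (UNIV :: 'u set)" .
  then have "Fpow I \<times> Arr C \<lesssim> (UNIV :: 'u set)"
    using small_category times_lepoll_mono square lepoll_trans by blast
  moreover have "generalized_elements \<subseteq> Fpow I \<times> Arr C" by (auto simp: generalized_elements_def)
  ultimately have "generalized_elements \<lesssim> (UNIV :: 'u set)"
    using subset_imp_lepoll lepoll_trans by blast
  then obtain c :: "('o \<times> 'p) set \<times> 'a \<Rightarrow> 'u" where c: "\<forall>x\<in>generalized_elements.
      \<forall>y\<in>generalized_elements. c x = c y \<longleftrightarrow> (x, y) \<in> eventually_equal"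
    using ex_class_code[OF equiv_eventually_equal] by blast
  obtain U where U: "coherent U" "\<And>S. S \<in> Fpow I \<Longrightarrow> refuting S \<subseteq> U S"
    "\<And>S. S \<in> Fpow I \<Longrightarrow> ultrafilter (fib S) (U S)"
    using coherent_ultrafilters[OF refuting_coherent] by blast
  interpret ultrafilter_diagram C P "Fpow I" Z proj "\<lambda>s f. c (s, f)" U
    by unfold_locales (use c U in auto)

  have "F X = {\<alpha> \<in> carrier (Fib P X). \<forall>x\<in>colim X. x \<in> interp X \<alpha>}" if X: "X \<in> Obj C" for X
  proof (intro equalityI subsetI)
    fix \<alpha> assume \<alpha>: "\<alpha> \<in> F X"
    then have carr: "\<alpha> \<in> carrier (Fib P X)" by (rule lattice_filter_carrier[OF F_filter[OF X]])
    have "x \<in> interp X \<alpha>" if x: "x \<in> colim X" for x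
    proof -
      obtain S f where S: "S \<in> Fpow I" "f \<in> Hom C (Z S) X" "x = c (S, f)"
        using x by (rule colimE)
      have "Reidx P f \<alpha> \<in> U S"
        using F_Reidx[OF S(2) \<alpha>] F_sub_refuting[OF S(1)] U(2)[OF S(1)] by blast
      then show ?thesis using code_in_interp_iff[OF S(1,2) carr] S(3) by simp
    qed
    with carr show "\<alpha> \<in> {\<alpha> \<in> carrier (Fib P X). \<forall>x\<in>colim X. x \<in> interp X \<alpha>}" by blast
  next
    fix \<alpha> assume "\<alpha> \<in> {\<alpha> \<in> carrier (Fib P X). \<forall>x\<in>colim X. x \<in> interp X \<alpha>}"
    then have carr: "\<alpha> \<in> carrier (Fib P X)" and valid: "\<forall>x\<in>colim X. x \<in> interp X \<alpha>" by auto
    show "\<alpha> \<in> F X"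
    proof (rule ccontr)
      assume "\<alpha> \<notin> F X"
      let ?i = "(X, \<alpha>)"
      have S: "{?i} \<in> Fpow I" using X carr \<open>\<alpha> \<notin> F X\<close> by (auto simp: I_def Fpow_def)
      interpret S: boolean_alg "fib {?i}" by (rule fib_boolean[OF S])
      have \<pi>: "\<pi> {?i} ?i \<in> Hom C (Z {?i}) X" using \<pi>_in[OF S, of ?i] by simp
      \<comment> \<open>The counterexample is the constant introduced for \<alpha>, seen in the
        context containing only that constant; the ultrafilter there contains the negated
        instance.\<close>
      have "instance_at {?i} ?i \<notin> U {?i}"
        using compl_instance_refuting[OF S, of ?i] U(2)[OF S]
          S.ultrafilter_compl[OF U(3)[OF S] instance_closed[OF S]] by auto
      then have "c ({?i}, \<pi> {?i} ?i) \<notin> interp X \<alpha>"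
        using code_in_interp_iff[OF S \<pi> carr] by (simp add: instance_at_def)
      with valid colimI[OF S \<pi>] show False by blast
    qed
  qed
  then show ?thesis
    using interp_propositional_model[OF universe]
    by (intro exI[of _ colim_functor] exI[of _ interp]) (simp add: colim_functor_simps)
qed

theorem theorem3p25:
  fixes C :: "('o, 'a) cat" and P :: "('o, 'a, 'p) doctrine" and F :: "'o \<Rightarrow> 'p set"
  assumes doctrine: "boolean_doctrine C P"
    and universe: "infinite (UNIV :: 'u set)"
    and small_category: "Arr C \<lesssim> (UNIV :: 'u set)"
    and small_fibres: "\<And>X. X \<in> Obj C \<Longrightarrow> carrier (Fib P X) \<lesssim> (UNIV :: 'u set)"
    and family: "\<And>X. X \<in> Obj C \<Longrightarrow> F X \<subseteq> carrier (Fib P X)"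
  shows "(\<exists>(M :: ('o, 'a, 'u set, 'u set_arr) func) \<mm>.
            propositional_model C P M \<mm> \<and>
            (\<forall>X\<in>Obj C. F X = {\<alpha> \<in> carrier (Fib P X). \<forall>x\<in>FObj M X. x \<in> \<mm> X \<alpha>}))
         \<longleftrightarrow> universal_ultrafilter C P F"
proof
  assume "\<exists>(M :: ('o, 'a, 'u set, 'u set_arr) func) \<mm>. propositional_model C P M \<mm> \<and>
    (\<forall>X\<in>Obj C. F X = {\<alpha> \<in> carrier (Fib P X). \<forall>x\<in>FObj M X. x \<in> \<mm> X \<alpha>})"
  then show "universal_ultrafilter C P F"
    by (elim exE conjE, intro propositional_model_universal_ultrafilter) auto
qed (rule boolean_doctrine.universal_ultrafilter_model[OF doctrine universe small_category small_fibres])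

end
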